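(* Consider the regression model $y=X\beta+\epsilon$ with $\epsilon\sim\mathcal E_n(0,\sigma^2V,g)$, and the quadratic risk $R(\beta^*;\beta)=E[(\beta^*-\beta)'\mathbf W(\beta^*-\beta)]$ for a given positive definite $p\times p$ matrix $\mathbf W$. Let $ch_1(A_{11})$ and $ch_q(A_{11})$ denote the minimum and maximum eigenvalues of $A_{11}$. Then the restricted estimator $\hat\beta$ dominates the generalized least squares estimator $\tilde\beta$, i.e. $R(\hat\beta;\beta)\le R(\tilde\beta;\beta)$, whenever $$\Delta_*^2\le\frac{\mathrm{tr}(A_{11})}{ch_q(A_{11})},$$ while $R(\tilde\beta;\beta)\le R(\hat\beta;\beta)$ whenever $$\Delta_*^2\ge\frac{\mathrm{tr}(A_{11})}{ch_1(A_{11})}.$$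
   Context: Model: $y=X\beta+\epsilon$, where $X$ is a fixed $n\times p$ matrix of full column rank $p<n$, $V$ is a known positive definite $n\times n$ matrix, $\beta\in\mathbb R^p$ and $\sigma>0$ are unknown, and $\epsilon\sim\mathcal E_n(0,\sigma^2V,g)$ has density $|\sigma^2V|^{-1/2}g(\epsilon'V^{-1}\epsilon/\sigma^2)$ of the form $$f_\epsilon(x)=\int_0^\infty \phi_{N_n(0,t^{-1}\sigma^2V)}(x)\,\mathcal W(dt),$$ where $\phi_{N_n(0,\Sigma)}$ is the density of $N_n(0,\Sigma)$ and $\mathcal W$ is a (possibly signed) measure on $(0,\infty)$, not depending on $\beta,\sigma$, with $\int_0^\infty\mathcal W(dt)=1$ and with Jordan decomposition $\mathcal W=\mathcal W^+-\mathcal W^-$ satisfying $\int t^{-1}\mathcal W^\pm(dt)<\infty$. Put $\sigma_\epsilon^2=\sigma^2\int_0^\infty t^{-1}\mathcal W(dt)$, so that $\mathrm{Cov}(\epsilon)=\sigma_\epsilon^2V$. Estimators: $C=X'V^{-1}X$; $\tilde\beta=C^{-1}X'V^{-1}y$; $H$ is a known $q\times p$ matrix of full row rank $q<p$, $h\in\mathbb R^q$ is known, $V_1=(HC^{-1}H')^{-1}$; $\hat\beta=\tilde\beta-C^{-1}H'V_1(H\tilde\beta-h)$. $\Delta_*^2=\theta/\sigma_\epsilon^2$ with $\theta=(H\beta-h)'V_1(H\beta-h)$. The matrix $C^{-1/2}H'V_1HC^{-1/2}$ is a symmetric idempotent of rank $q$; $Q$ is an orthogonal matrix with $Q\,C^{-1/2}H'V_1HC^{-1/2}Q'=\begin{pmatrix}I_q&0\\0&0\end{pmatrix}$,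 and $A_{11}$ is the upper-left $q\times q$ block of $A=QC^{-1/2}\mathbf WC^{-1/2}Q'$. *)

theory Defs
  imports "HOL-Probability.Probability"
begin

section \<open>Matrices\<close>

definition pos_def :: "real^'n^'n \<Rightarrow> bool" where
  "pos_def A \<longleftrightarrow> transpose A = A \<and> (\<forall>x. x \<noteq> 0 \<longrightarrow> x \<bullet> (A *v x) > 0)"

text \<open>A positive definite matrix has exactly one positive definite square root;
  \<open>pd_sqrt (matrix_inv C)\<close> is $C^{-1/2}$.\<close>

definition pd_sqrt :: "real^'n^'n \<Rightarrow> real^'n^'n" where
  "pd_sqrt A = (THE S. pos_def S \<and> S ** S = A)"

text \<open>Only real eigenvalues are considered, which loses nothing for symmetric matrices;
  for these the set is moreover finite and nonempty, so that \<open>Min\<close> and \<open>Max\<close> are meaningful.\<close>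

definition eigenvalues :: "real^'n^'n \<Rightarrow> real set" where
  "eigenvalues A = {c. \<exists>v. v \<noteq> 0 \<and> A *v v = c *\<^sub>R v}"

definition ch_min :: "real^'n^'n \<Rightarrow> real" where
  "ch_min A = Min (eigenvalues A)"

definition ch_max :: "real^'n^'n \<Rightarrow> real" where
  "ch_max A = Max (eigenvalues A)"

text \<open>Index types carry no order, so the first $q$ of the $p$ coordinates are
  designated by an injection \<open>e :: 'q \<Rightarrow> 'p\<close>: the rows and columns
  in \<open>range e\<close> make up the upper-left block.\<close>

definition upper_left_block :: "('q \<Rightarrow> 'p) \<Rightarrow> real^'p^'p \<Rightarrow> real^'q^'q" where
  "upper_left_block e A = (\<chi> i j. A $ e i $ e j)"

text \<open>The block matrix $\mathrm{diag}(I_q, 0)$.\<close>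

definition block_id :: "('q \<Rightarrow> 'p) \<Rightarrow> real^'p^'p" where
  "block_id e = (\<chi> i j. if i = j \<and> i \<in> range e then 1 else 0)"

section \<open>Signed measures\<close>

text \<open>Real-valued, hence finite, signed measures on the measurable sets of \<open>M\<close>
  (the measure carried by \<open>M\<close> itself is irrelevant).\<close>

definition signed_measure :: "'a measure \<Rightarrow> ('a set \<Rightarrow> real) \<Rightarrow> bool" where
  "signed_measure M \<nu> \<longleftrightarrow> \<nu> {} = 0 \<and>
     (\<forall>A :: nat \<Rightarrow> 'a set. range A \<subseteq> sets M \<longrightarrow> disjoint_family A \<longrightarrow>
        (\<lambda>i. \<nu> (A i)) sums \<nu> (\<Union>i. A i))"

definition jordan_decomposition ::
    "'a measure \<Rightarrow> ('a set \<Rightarrow> real) \<Rightarrow> 'a measure \<Rightarrow> 'a measure \<Rightarrow> bool" where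
  "jordan_decomposition M \<nu> \<nu>p \<nu>m \<longleftrightarrow>
     sets \<nu>p = sets M \<and> sets \<nu>m = sets M \<and> finite_measure \<nu>p \<and> finite_measure \<nu>m \<and>
     (\<exists>P\<in>sets M. emeasure \<nu>m P = 0 \<and> emeasure \<nu>p (space M - P) = 0) \<and>
     (\<forall>A\<in>sets M. \<nu> A = measure \<nu>p A - measure \<nu>m A)"

text \<open>The integral against the signed measure with Jordan decomposition \<open>\<nu>p - \<nu>m\<close>.\<close>

definition signed_integral :: "'a measure \<Rightarrow> 'a measure \<Rightarrow> ('a \<Rightarrow> real) \<Rightarrow> real" where
  "signed_integral \<nu>p \<nu>m f = (LINT t|\<nu>p. f t) - (LINT t|\<nu>m. f t)"

section \<open>Distributions\<close>

definition mvn_density :: "real^'n \<Rightarrow> real^'n^'n \<Rightarrow> real^'n \<Rightarrow> real" where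
  "mvn_density \<mu> \<Sigma> x =
     (2 * pi) powr (- real CARD('n) / 2) * det \<Sigma> powr (- 1 / 2) *
     exp (- ((x - \<mu>) \<bullet> (matrix_inv \<Sigma> *v (x - \<mu>))) / 2)"

definition elliptical_density ::
    "real^'n \<Rightarrow> real^'n^'n \<Rightarrow> (real \<Rightarrow> real) \<Rightarrow> real^'n \<Rightarrow> real" where
  "elliptical_density \<mu> \<Sigma> g x =
     det \<Sigma> powr (- 1 / 2) * g ((x - \<mu>) \<bullet> (matrix_inv \<Sigma> *v (x - \<mu>)))"

definition elliptically_distributed ::
    "'a measure \<Rightarrow> ('a \<Rightarrow> real^'n) \<Rightarrow> real^'n \<Rightarrow> real^'n^'n \<Rightarrow> (real \<Rightarrow> real) \<Rightarrow> bool" where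
  "elliptically_distributed M \<epsilon> \<mu> \<Sigma> g \<longleftrightarrow>
     (\<forall>u\<ge>0. 0 \<le> g u) \<and>
     distributed M lborel \<epsilon> (\<lambda>x. ennreal (elliptical_density \<mu> \<Sigma> g x))"

section \<open>Estimation in the linear model\<close>

definition gls_C :: "real^'p^'n \<Rightarrow> real^'n^'n \<Rightarrow> real^'p^'p" where
  "gls_C X V = transpose X ** matrix_inv V ** X"

definition gls_V1 :: "real^'p^'n \<Rightarrow> real^'n^'n \<Rightarrow> real^'p^'q \<Rightarrow> real^'q^'q" where
  "gls_V1 X V H = matrix_inv (H ** matrix_inv (gls_C X V) ** transpose H)"

definition gls_estimator :: "real^'p^'n \<Rightarrow> real^'n^'n \<Rightarrow> real^'n \<Rightarrow> real^'p" where
  "gls_estimator X V y = (matrix_inv (gls_C X V) ** transpose X ** matrix_inv V) *v y"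

definition restricted_estimator ::
    "real^'p^'n \<Rightarrow> real^'n^'n \<Rightarrow> real^'p^'q \<Rightarrow> real^'q \<Rightarrow> real^'n \<Rightarrow> real^'p" where
  "restricted_estimator X V H h y =
     gls_estimator X V y -
       (matrix_inv (gls_C X V) ** transpose H ** gls_V1 X V H) *v
         (H *v gls_estimator X V y - h)"

definition quadratic_risk ::
    "'a measure \<Rightarrow> real^'p^'p \<Rightarrow> ('a \<Rightarrow> real^'p) \<Rightarrow> real^'p \<Rightarrow> real" where
  "quadratic_risk M W b \<beta> = (LINT \<omega>|M. (b \<omega> - \<beta>) \<bullet> (W *v (b \<omega> - \<beta>)))"

definition restriction_theta ::
    "real^'p^'n \<Rightarrow> real^'n^'n \<Rightarrow> real^'p^'q \<Rightarrow> real^'q \<Rightarrow> real^'p \<Rightarrow> real" where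
  "restriction_theta X V H h \<beta> = (H *v \<beta> - h) \<bullet> (gls_V1 X V H *v (H *v \<beta> - h))"

end

theory Submission
  imports Defs "HOL-Real_Asymp.Real_Asymp"
begin

text \<open>
  Write \<open>\<delta> = H\<beta> - h\<close>, \<open>L = C\<^bsup>-1/2\<^esup>\<close> and \<open>P = C\<^bsup>-1\<^esup> H' V\<^sub>1 H C\<^bsup>-1\<^esup>\<close>. Both estimation errors
  are affine in \<open>\<epsilon>\<close>, which has mean 0 and covariance \<open>\<sigma>\<epsilon>2 V\<close>; their linear parts have covariances
  proportional to \<open>C\<^bsup>-1\<^esup>\<close> and \<open>C\<^bsup>-1\<^esup> - P\<close>, and \<open>tr (W P) = tr A\<^sub>1\<^sub>1\<close>. In the coordinates given by \<open>Q\<close> the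
  bias \<open>- C\<^bsup>-1\<^esup> H' V\<^sub>1 \<delta>\<close> becomes \<open>\<eta> = Q L H' V\<^sub>1 \<delta>\<close> up to sign. It is supported on the first \<open>q\<close>
  coordinates \<open>\<eta>\<^sub>1\<close>, with \<open>|\<eta>\<^sub>1|\<^sup>2 = \<theta>\<close>. The risk of the GLS estimator therefore exceeds that of the
  restricted one by \<open>\<sigma>\<epsilon>2 tr A\<^sub>1\<^sub>1 - \<eta>\<^sub>1' A\<^sub>1\<^sub>1 \<eta>\<^sub>1\<close>, and the Rayleigh bounds decide the sign.

  The covariance of \<open>\<epsilon>\<close> is obtained by Fubini from that of the Gaussian kernels. Their total mass is
  only shown not to depend on the scale \<open>t\<close>: it is then 1 because the mixture is a probability
  density and the signed mixing measure has mass 1.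
\<close>

section \<open>Symmetric and positive definite matrices\<close>

lemma inner_matrix_vector_transpose:
  fixes A :: "real^'n^'m"
  shows "x \<bullet> (A *v y) = (transpose A *v x) \<bullet> y"
  by (simp add: transpose_matrix_vector dot_lmul_matrix)

lemma symmetric_matrix_iff_self_adjoint:
  fixes A :: "real^'n^'n"
  shows "transpose A = A \<longleftrightarrow> (\<forall>x y. x \<bullet> (A *v y) = (A *v x) \<bullet> y)"
proof
  assume sa: "\<forall>x y. x \<bullet> (A *v y) = (A *v x) \<bullet> y"
  have "transpose A *v x = A *v x" for x
  proof (rule vector_eq_rdot[THEN iffD1], rule allI)
    show "(transpose A *v x) \<bullet> z = (A *v x) \<bullet> z" for z
      using sa inner_matrix_vector_transpose[of x A z] by metis
  qed
  then show "transpose A = A" by (metis matrix_eq)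
qed (metis inner_matrix_vector_transpose)

text \<open>First-order condition for the Rayleigh quotient: moving from \<open>v\<close> along the
  residual \<open>w = A *v v - l *\<^sub>R v\<close> changes the form, relative to the bound
  \<open>l\<close>, by 2 t |w|^2 + O(t^2), so a nonzero \<open>w\<close> contradicts maximality.
  Invariance of \<open>S\<close> keeps \<open>w\<close> inside \<open>S\<close>.\<close>

lemma symmetric_maximizer_is_eigenvector:
  fixes A :: "real^'n^'n"
  assumes A: "transpose A = A" and S: "subspace S" and inv: "\<And>x. x \<in> S \<Longrightarrow> A *v x \<in> S"
    and v: "v \<in> S" "norm v = 1"
    and max: "\<And>x. x \<in> S \<Longrightarrow> norm x = 1 \<Longrightarrow> x \<bullet> (A *v x) \<le> v \<bullet> (A *v v)"
  shows "A *v v = (v \<bullet> (A *v v)) *\<^sub>R v"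
proof -
  define l where "l = v \<bullet> (A *v v)"
  define w where "w = A *v v - l *\<^sub>R v"
  have w: "w \<in> S" unfolding w_def using S inv v by (intro subspace_diff subspace_scale) auto
  have le: "x \<bullet> (A *v x) \<le> l * (x \<bullet> x)" if "x \<in> S" for x
  proof (cases "x = 0")
    case False
    have "(x /\<^sub>R norm x) \<bullet> (A *v (x /\<^sub>R norm x)) \<le> l"
      unfolding l_def using S that False by (intro max subspace_scale) auto
    then have "x \<bullet> (A *v x) / (norm x)\<^sup>2 \<le> l"
      by (simp add: matrix_vector_mult_scaleR power2_eq_square field_simps)
    then show ?thesis using False
      by (simp add: divide_le_eq power2_norm_eq_inner)
  qed simp
  have sym: "w \<bullet> (A *v v) = v \<bullet> (A *v w)"
    using A by (metis inner_matrix_vector_transpose inner_commute)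
  have vv: "v \<bullet> v = 1" using v by (simp add: norm_eq_1)
  define k where "k = w \<bullet> (A *v w) - l * (w \<bullet> w)"
  have vAw: "v \<bullet> (A *v w) = w \<bullet> w + l * (w \<bullet> v)"
    unfolding sym[symmetric] by (simp add: w_def inner_diff_left inner_diff_right algebra_simps)
  have key: "2 * t * (w \<bullet> w) + t\<^sup>2 * k \<le> 0" for t
  proof -
    have "v + t *\<^sub>R w \<in> S" using S v w by (intro subspace_add subspace_scale)
    from le[OF this] show ?thesis
      unfolding k_def
      by (simp add: matrix_vector_right_distrib matrix_vector_mult_scaleR inner_add_left
          inner_add_right inner_commute[of v w] l_def[symmetric] vv sym vAw algebra_simps power2_eq_square)
  qed
  have "w \<bullet> w \<le> 0"
  proof (rule ccontr)
    assume "\<not> ?thesis"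
    then have pos: "w \<bullet> w > 0" by linarith
    \<comment> \<open>Small enough that the quadratic term t |k| is at most
      \<open>w \<bullet> w\<close>, half of the coefficient of the linear term.\<close>
    define t where "t = (w \<bullet> w) / (\<bar>k\<bar> + 1)"
    have t: "t > 0" using pos by (simp add: t_def)
    have "t * \<bar>k\<bar> \<le> w \<bullet> w" using pos by (simp add: t_def field_simps)
    moreover have "t * - k \<le> t * \<bar>k\<bar>" using t by (intro mult_left_mono) auto
    ultimately have "2 * (w \<bullet> w) + t * k > 0" using pos
      unfolding mult_minus_right by linarith
    then have "t * (2 * (w \<bullet> w) + t * k) > 0" using t by simp
    then show False using key[of t] by (simp add: algebra_simps power2_eq_square)
  qed
  then have "w = 0" by (metis inner_eq_zero_iff inner_ge_zero order_antisym)
  then show ?thesis by (simp add: w_def l_def)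
qed

text \<open>Induction on the dimension: the form attains its maximum on the compact unit sphere of
  \<open>S\<close> at an eigenvector \<open>v\<close>, and by symmetry the orthogonal complement of
  \<open>v\<close> within \<open>S\<close> is again invariant.\<close>

lemma symmetric_invariant_subspace_eigenbasis:
  fixes A :: "real^'n^'n"
  assumes A: "transpose A = A"
  shows "subspace S \<Longrightarrow> (\<And>x. x \<in> S \<Longrightarrow> A *v x \<in> S) \<Longrightarrow>
    \<exists>B. finite B \<and> pairwise orthogonal B \<and> (\<forall>b\<in>B. norm b = 1 \<and> (\<exists>c. A *v b = c *\<^sub>R b)) \<and> span B = S"
proof (induction "dim S" arbitrary: S rule: less_induct)
  case less
  show ?case
  proof (cases "S = {0}")
    case True
    then show ?thesis by (intro exI[of _ "{}"]) auto
  next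
    case False
    let ?K = "S \<inter> sphere 0 1"
    have "compact ?K"
      by (simp add: closed_subspace less.prems(1) closed_Int_compact)
    moreover obtain x where x: "x \<in> S" "x \<noteq> 0"
      using False less.prems(1) subspace_0 by blast
    then have "x /\<^sub>R norm x \<in> ?K" using less.prems(1) by (simp add: subspace_scale)
    then have "?K \<noteq> {}" by blast
    moreover have "continuous_on ?K (\<lambda>x. x \<bullet> (A *v x))"
      by (intro continuous_intros linear_continuous_on matrix_vector_mul_bounded_linear)
    ultimately have "\<exists>v\<in>?K. \<forall>x\<in>?K. x \<bullet> (A *v x) \<le> v \<bullet> (A *v v)"
      by (intro continuous_attains_sup)
    then obtain v where v: "v \<in> S" "norm v = 1"
      and max: "\<And>x. x \<in> S \<Longrightarrow> norm x = 1 \<Longrightarrow> x \<bullet> (A *v x) \<le> v \<bullet> (A *v v)"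
      by (metis IntE IntI dist_0_norm mem_sphere)
    have ev: "A *v v = (v \<bullet> (A *v v)) *\<^sub>R v"
      by (rule symmetric_maximizer_is_eigenvector[OF A less.prems v max])
    have vv: "v \<bullet> v = 1" using v by (simp add: norm_eq_1)
    define S' where "S' = S \<inter> {x. v \<bullet> x = 0}"
    have S': "subspace S'"
      unfolding S'_def using less.prems(1) by (intro subspace_inter subspace_hyperplane)
    have "v \<notin> S'" using vv by (simp add: S'_def)
    then have "S' \<subset> S" using v(1) unfolding S'_def by blast
    then have "dim S' < dim S"
      by (metis S' dim_psubset less.prems(1) span_eq_iff)
    moreover have "A *v x \<in> S'" if "x \<in> S'" for x
    proof -
      have "v \<bullet> (A *v x) = (A *v v) \<bullet> x" using A by (simp add: inner_matrix_vector_transpose)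
      also have "\<dots> = 0" using that by (subst ev) (simp add: S'_def)
      finally show ?thesis using that less.prems(2) by (simp add: S'_def)
    qed
    ultimately obtain B where B: "finite B" "pairwise orthogonal B"
      "\<forall>b\<in>B. norm b = 1 \<and> (\<exists>c. A *v b = c *\<^sub>R b)" "span B = S'"
      using less.hyps[of S'] S' by blast
    have vB: "v \<bullet> b = 0" if "b \<in> B" for b
      using that B(4) span_base[of b B] by (auto simp: S'_def)
    have "span (insert v B) = S"
    proof
      show "span (insert v B) \<subseteq> S"
        using v B(4) span_superset[of B] less.prems(1) by (intro span_minimal) (auto simp: S'_def)
      show "S \<subseteq> span (insert v B)"
      proof
        fix x assume x: "x \<in> S"
        have "x - (v \<bullet> x) *\<^sub>R v \<in> S'"
          using x v vv less.prems(1)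
          by (auto simp: S'_def inner_diff_right intro!: subspace_diff subspace_scale)
        then show "x \<in> span (insert v B)"
          using B(4) by (auto simp: span_insert)
      qed
    qed
    then show ?thesis
      using B v ev vB
      by (intro exI[of _ "insert v B"])
        (auto simp: pairwise_insert orthogonal_def inner_commute)
  qed
qed

lemma symmetric_matrix_spectral:
  fixes A :: "real^'n^'n"
  assumes "transpose A = A"
  obtains B c where "finite B" "\<And>b b'. b \<in> B \<Longrightarrow> b' \<in> B \<Longrightarrow> b \<bullet> b' = (if b = b' then 1 else 0)"
    "\<And>x. (\<Sum>b\<in>B. (x \<bullet> b) *\<^sub>R b) = x" "\<And>b. b \<in> B \<Longrightarrow> A *v b = c b *\<^sub>R b"
proof -
  obtain B where B: "finite B" "pairwise orthogonal B"
    "\<forall>b\<in>B. norm b = 1 \<and> (\<exists>c. A *v b = c *\<^sub>R b)" "span B = UNIV"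
    using symmetric_invariant_subspace_eigenbasis[OF assms, of UNIV] by auto
  then obtain c where "\<And>b. b \<in> B \<Longrightarrow> A *v b = c b *\<^sub>R b" by metis
  moreover have "(\<Sum>b\<in>B. (x \<bullet> b) *\<^sub>R b) = x" for x
    using B by (intro orthonormal_basis_expand) auto
  moreover have "b \<bullet> b' = (if b = b' then 1 else 0)" if "b \<in> B" "b' \<in> B" for b b'
    using B that by (auto simp: pairwise_def orthogonal_def norm_eq_1)
  ultimately show ?thesis using that B(1) by blast
qed

lemma matrix_vector_mult_sum_right:
  fixes A :: "real^'n^'m"
  shows "A *v (\<Sum>i\<in>I. f i) = (\<Sum>i\<in>I. A *v f i)"
  by (induction I rule: infinite_finite_induct) (auto simp: matrix_vector_right_distrib)

lemma inner_orthonormal_expansion: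
  fixes x y :: "'a::real_inner"
  assumes "\<And>x::'a. (\<Sum>b\<in>B. (x \<bullet> b) *\<^sub>R b) = x"
  shows "x \<bullet> y = (\<Sum>b\<in>B. (x \<bullet> b) * (y \<bullet> b))"
proof -
  have "x \<bullet> y = (\<Sum>b\<in>B. (x \<bullet> b) *\<^sub>R b) \<bullet> y" by (simp only: assms)
  also have "\<dots> = (\<Sum>b\<in>B. (x \<bullet> b) * (y \<bullet> b))"
    by (simp add: inner_sum_left inner_commute[of y])
  finally show ?thesis .
qed

text \<open>In an orthonormal eigenbasis the form is the sum of the squared coordinates weighted by
  the eigenvalues. The eigenvalues are exactly the image of the basis under \<open>c\<close>, hence
  finite in number and at least one, so that \<open>Min\<close> and \<open>Max\<close> are
  attained.\<close>

lemma Rayleigh_bounds: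
  fixes A :: "real^'n^'n"
  assumes A: "transpose A = A"
  shows "ch_min A * (x \<bullet> x) \<le> x \<bullet> (A *v x)" "x \<bullet> (A *v x) \<le> ch_max A * (x \<bullet> x)"
    and "ch_min A \<in> eigenvalues A" "ch_max A \<in> eigenvalues A"
proof -
  obtain B c where B: "finite B" "\<And>b b'. b \<in> B \<Longrightarrow> b' \<in> B \<Longrightarrow> b \<bullet> b' = (if b = b' then 1 else 0)"
    "\<And>x. (\<Sum>b\<in>B. (x \<bullet> b) *\<^sub>R b) = x" "\<And>b. b \<in> B \<Longrightarrow> A *v b = c b *\<^sub>R b"
    by (rule symmetric_matrix_spectral[OF A]) (rule that)
  have Ab: "(A *v x) \<bullet> b = c b * (x \<bullet> b)" if "b \<in> B" for x b
    using A B(4)[OF that] by (metis inner_matrix_vector_transpose inner_scaleR_right)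
  have ne: "\<exists>b\<in>B. x \<bullet> b \<noteq> 0" if "x \<noteq> 0" for x :: "real^'n"
    using that B(3)[of x] by (metis (no_types, lifting) scaleR_zero_left sum.neutral)
  have eig: "eigenvalues A = c ` B"
  proof
    show "eigenvalues A \<subseteq> c ` B"
    proof
      fix k assume "k \<in> eigenvalues A"
      then obtain v where v: "v \<noteq> 0" "A *v v = k *\<^sub>R v" by (auto simp: eigenvalues_def)
      obtain b where "b \<in> B" "v \<bullet> b \<noteq> 0" using ne[OF v(1)] by blast
      then show "k \<in> c ` B" using Ab[of b v] v(2) by auto
    qed
    have "b \<noteq> 0" if "b \<in> B" for b using B(2)[OF that that] by auto
    then show "c ` B \<subseteq> eigenvalues A" using B(4) unfolding eigenvalues_def by blast
  qed
  \<comment> \<open>\<open>axis undefined 1\<close> merely serves as some nonzero vector.\<close>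
  have "B \<noteq> {}" using ne[of "axis undefined 1"] by (auto simp: axis_eq_0_iff)
  then have fin: "finite (eigenvalues A)" "eigenvalues A \<noteq> {}" using B(1) eig by auto
  then show "ch_min A \<in> eigenvalues A" "ch_max A \<in> eigenvalues A"
    by (auto simp: ch_min_def ch_max_def)
  have q: "x \<bullet> (A *v x) = (\<Sum>b\<in>B. c b * (x \<bullet> b)\<^sup>2)"
    by (subst inner_orthonormal_expansion[of B, OF B(3)])
      (auto simp: Ab power2_eq_square intro!: sum.cong)
  have n: "k * (x \<bullet> x) = (\<Sum>b\<in>B. k * (x \<bullet> b)\<^sup>2)" for k
    by (subst inner_orthonormal_expansion[of B, OF B(3)])
      (simp add: power2_eq_square sum_distrib_left)
  show "ch_min A * (x \<bullet> x) \<le> x \<bullet> (A *v x)" "x \<bullet> (A *v x) \<le> ch_max A * (x \<bullet> x)"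
    unfolding q n using fin eig
    by (auto simp: ch_min_def ch_max_def intro!: sum_mono mult_right_mono)
qed

section \<open>Positive definite matrices: inverses, congruences, square roots\<close>

lemma pos_def_sym: "pos_def A \<Longrightarrow> transpose A = A"
  and pos_def_pos: "pos_def A \<Longrightarrow> x \<noteq> 0 \<Longrightarrow> x \<bullet> (A *v x) > 0"
  by (auto simp: pos_def_def)

lemma pos_def_eigenvalue_pos:
  assumes "pos_def A" "k \<in> eigenvalues A" shows "k > 0"
proof -
  obtain v where v: "v \<noteq> 0" "A *v v = k *\<^sub>R v" using assms(2) by (auto simp: eigenvalues_def)
  then have "k * (v \<bullet> v) > 0" using pos_def_pos[OF assms(1) v(1)] by simp
  then show ?thesis using v(1) by (meson inner_gt_zero_iff zero_less_mult_pos2)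
qed

lemma pos_def_invertible:
  fixes A :: "real^'n^'n"
  assumes "pos_def A" shows "invertible A"
proof -
  have "x = 0" if "A *v x = 0" for x
    using pos_def_pos[OF assms, of x] that by force
  then show ?thesis
    by (metis invertible_left_inverse matrix_left_invertible_ker)
qed

lemma matrix_inv_mult:
  fixes A :: "real^'n^'n"
  assumes "invertible A"
  shows "A ** matrix_inv A = mat 1" "matrix_inv A ** A = mat 1"
proof -
  have "\<exists>B. A ** B = mat 1 \<and> B ** A = mat 1" using assms by (simp add: invertible_def)
  then have "A ** matrix_inv A = mat 1 \<and> matrix_inv A ** A = mat 1"
    unfolding matrix_inv_def by (rule someI_ex)
  then show "A ** matrix_inv A = mat 1" "matrix_inv A ** A = mat 1" by auto
qed

lemma pos_def_matrix_inv:
  fixes A :: "real^'n^'n"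
  assumes A: "pos_def A" shows "pos_def (matrix_inv A)"
  unfolding pos_def_def
proof (intro conjI allI impI)
  note inv = matrix_inv_mult[OF pos_def_invertible[OF A]]
  have "A ** transpose (matrix_inv A) = mat 1"
    using inv(2) pos_def_sym[OF A] by (metis matrix_transpose_mul transpose_mat)
  then show "transpose (matrix_inv A) = matrix_inv A"
    using inv by (metis matrix_mul_assoc matrix_mul_lid matrix_mul_rid)
  fix x :: "real^'n" assume "x \<noteq> 0"
  define z where "z = matrix_inv A *v x"
  have x: "x = A *v z" by (simp add: z_def matrix_vector_mul_assoc inv)
  then have "z \<noteq> 0" using \<open>x \<noteq> 0\<close> by auto
  then show "x \<bullet> (matrix_inv A *v x) > 0"
    using pos_def_pos[OF A] x unfolding z_def[symmetric] by (metis inner_commute)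
qed

lemma pos_def_congruence:
  fixes A :: "real^'n^'n" and T :: "real^'m^'n"
  assumes A: "pos_def A" and inj: "\<And>x. T *v x = 0 \<Longrightarrow> x = 0"
  shows "pos_def (transpose T ** A ** T)"
  unfolding pos_def_def
proof (intro conjI allI impI)
  show "transpose (transpose T ** A ** T) = transpose T ** A ** T"
    using pos_def_sym[OF A] by (simp add: matrix_transpose_mul matrix_mul_assoc)
  fix x :: "real^'m" assume "x \<noteq> 0"
  then have "T *v x \<noteq> 0" using inj by auto
  then show "x \<bullet> ((transpose T ** A ** T) *v x) > 0"
    using pos_def_pos[OF A]
    by (metis inner_matrix_vector_transpose matrix_vector_mul_assoc transpose_transpose)
qed

lemma pos_def_square_root_exists:
  fixes A :: "real^'n^'n"
  assumes A: "pos_def A"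
  shows "\<exists>S. pos_def S \<and> S ** S = A"
proof -
  obtain B c where B: "finite B" "\<And>b b'. b \<in> B \<Longrightarrow> b' \<in> B \<Longrightarrow> b \<bullet> b' = (if b = b' then 1 else 0)"
    "\<And>x. (\<Sum>b\<in>B. (x \<bullet> b) *\<^sub>R b) = x" "\<And>b. b \<in> B \<Longrightarrow> A *v b = c b *\<^sub>R b"
    by (rule symmetric_matrix_spectral[OF pos_def_sym[OF A]]) (rule that)
  have b0: "b \<noteq> 0" if "b \<in> B" for b using B(2)[OF that that] by auto
  have c: "c b > 0" if "b \<in> B" for b
    using that b0 B(4) pos_def_eigenvalue_pos[OF A] unfolding eigenvalues_def by blast
  \<comment> \<open>The root keeps the eigenvectors of \<open>A\<close> and takes the square roots
    of its eigenvalues.\<close>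
  define S where "S = matrix (\<lambda>x::real^'n. \<Sum>b\<in>B. (sqrt (c b) * (x \<bullet> b)) *\<^sub>R b)"
  have lin: "linear (\<lambda>x::real^'n. \<Sum>b\<in>B. (sqrt (c b) * (x \<bullet> b)) *\<^sub>R b)"
    by (intro linearI)
      (simp_all add: inner_add_left algebra_simps sum.distrib scaleR_sum_right)
  have Sv: "S *v x = (\<Sum>b\<in>B. (sqrt (c b) * (x \<bullet> b)) *\<^sub>R b)" for x
    unfolding S_def using fun_cong[OF matrix_vector_mul(2)[OF lin], of x] by simp
  have Sb: "S *v b = sqrt (c b) *\<^sub>R b" if "b \<in> B" for b
  proof -
    have "S *v b = (\<Sum>d\<in>B. if d = b then sqrt (c b) *\<^sub>R b else 0)"
      unfolding Sv using that B(2) by (intro sum.cong) auto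
    then show ?thesis using that B(1) by simp
  qed
  have "(S ** S) *v x = A *v x" for x
  proof -
    have "(S ** S) *v (\<Sum>b\<in>B. (x \<bullet> b) *\<^sub>R b) = A *v (\<Sum>b\<in>B. (x \<bullet> b) *\<^sub>R b)"
      unfolding matrix_vector_mult_sum_right
      by (intro sum.cong refl)
        (use c in \<open>auto simp: matrix_vector_mul_assoc[symmetric] matrix_vector_mult_scaleR Sb B(4)
          less_imp_le\<close>)
    then show ?thesis by (simp add: B(3))
  qed
  then have "S ** S = A" by (simp add: matrix_eq)
  moreover have "pos_def S"
    unfolding pos_def_def symmetric_matrix_iff_self_adjoint
  proof (intro conjI allI impI)
    show "x \<bullet> (S *v y) = (S *v x) \<bullet> y" for x y
      by (simp add: Sv inner_sum_left inner_sum_right inner_commute algebra_simps)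
    fix x :: "real^'n" assume "x \<noteq> 0"
    then obtain b where b: "b \<in> B" "x \<bullet> b \<noteq> 0"
      using B(3)[of x] by (metis (no_types, lifting) scaleR_zero_left sum.neutral)
    have "x \<bullet> (S *v x) = (\<Sum>b\<in>B. sqrt (c b) * (x \<bullet> b)\<^sup>2)"
      by (simp add: Sv inner_sum_right power2_eq_square algebra_simps)
    also have "\<dots> > 0"
      using b c B(1) by (intro sum_pos2[of _ b]) (auto simp: less_imp_le)
    finally show "x \<bullet> (S *v x) > 0" .
  qed
  ultimately show ?thesis by blast
qed

lemma pos_def_square_root_unique:
  fixes S T :: "real^'n^'n"
  assumes S: "pos_def S" and T: "pos_def T" and eq: "S ** S = T ** T"
  shows "S = T"
proof -
  define D where "D = S - T"
  have D: "transpose D = D"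
    using pos_def_sym[OF S] pos_def_sym[OF T] by (auto simp: D_def transpose_def vec_eq_iff)
  obtain B c where B: "finite B" "\<And>b b'. b \<in> B \<Longrightarrow> b' \<in> B \<Longrightarrow> b \<bullet> b' = (if b = b' then 1 else 0)"
    "\<And>x. (\<Sum>b\<in>B. (x \<bullet> b) *\<^sub>R b) = x" "\<And>b. b \<in> B \<Longrightarrow> D *v b = c b *\<^sub>R b"
    by (rule symmetric_matrix_spectral[OF D]) (rule that)
  \<comment> \<open>\<open>S\<^sup>2 - T\<^sup>2 = S D + D T\<close>, so at an eigenvector \<open>b\<close> of \<open>D\<close> the form is \<open>c (b'S b + b'T b)\<close>.\<close>
  have "D *v b = 0" if b: "b \<in> B" for b
  proof -
    have b0: "b \<noteq> 0" using B(2)[OF b b] by auto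
    have "S *v (D *v b) + D *v (T *v b) = 0"
      using arg_cong[OF eq, of "\<lambda>M. M *v b"]
      by (simp add: D_def matrix_vector_mult_diff_rdistrib matrix_vector_mult_diff_distrib
          matrix_vector_mul_assoc[symmetric])
    then have "b \<bullet> (S *v (D *v b)) + b \<bullet> (D *v (T *v b)) = 0"
      by (metis inner_add_right inner_zero_right)
    moreover have "b \<bullet> (D *v (T *v b)) = (D *v b) \<bullet> (T *v b)"
      using D by (simp add: inner_matrix_vector_transpose)
    ultimately have "c b * (b \<bullet> (S *v b) + b \<bullet> (T *v b)) = 0"
      by (simp add: B(4)[OF b] matrix_vector_mult_scaleR algebra_simps)
    moreover have "b \<bullet> (S *v b) + b \<bullet> (T *v b) > 0"
      using pos_def_pos[OF S b0] pos_def_pos[OF T b0] by simp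
    ultimately show ?thesis using B(4)[OF b] by simp
  qed
  then have "D *v x = 0" for x
    using B(3)[of x] by (metis (no_types, lifting) matrix_vector_mult_scaleR
        matrix_vector_mult_sum_right scaleR_zero_right sum.neutral)
  then show ?thesis
    by (simp add: D_def matrix_eq matrix_vector_mult_diff_rdistrib)
qed

lemma pd_sqrt:
  fixes A :: "real^'n^'n"
  assumes "pos_def A"
  shows "pos_def (pd_sqrt A)" "pd_sqrt A ** pd_sqrt A = A"
proof -
  have "\<exists>!S. pos_def S \<and> S ** S = A"
    using pos_def_square_root_exists[OF assms] pos_def_square_root_unique by blast
  from theI'[OF this, folded pd_sqrt_def]
  show "pos_def (pd_sqrt A)" "pd_sqrt A ** pd_sqrt A = A" by auto
qed

text \<open>The determinant is the square of that of the root. The sign is what lets a real power of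
  a scaled determinant be split into factors.\<close>

lemma pos_def_det_nonneg:
  fixes A :: "real^'n^'n"
  assumes "pos_def A" shows "0 \<le> det A"
  using pd_sqrt(2)[OF assms] by (metis det_mul zero_le_square)

section \<open>Inverses, scalar multiples and differences of matrices\<close>

lemma matrix_inv_unique:
  fixes A B :: "real^'n^'n"
  assumes "A ** B = mat 1"
  shows "matrix_inv A = B"
proof -
  have "invertible A"
    using assms invertible_right_inverse by blast
  then show ?thesis
    using assms matrix_inv_mult(2)[of A] by (metis matrix_mul_assoc matrix_mul_lid matrix_mul_rid)
qed

lemma matrix_inv_scaleR:
  fixes A :: "real^'n^'n"
  assumes "invertible A" "k \<noteq> 0"
  shows "matrix_inv (k *\<^sub>R A) = (1 / k) *\<^sub>R matrix_inv A"
proof (rule matrix_inv_unique)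
  have "(k *\<^sub>R A ** (1 / k) *\<^sub>R matrix_inv A) *v x = mat 1 *v x" for x
    using assms by (simp add: matrix_vector_mul_assoc[symmetric] scaleR_matrix_vector_assoc[symmetric]
        matrix_vector_mult_scaleR) (simp add: matrix_vector_mul_assoc matrix_inv_mult)
  then show "k *\<^sub>R A ** (1 / k) *\<^sub>R matrix_inv A = mat 1" by (metis matrix_eq)
qed

lemma det_scaleR:
  fixes A :: "real^'n^'n"
  shows "det (k *\<^sub>R A) = k ^ CARD('n) * det A"
  by (simp add: det_def prod.distrib sum_distrib_left mult.left_commute)

lemma pos_def_scaleR:
  fixes A :: "real^'n^'n"
  assumes "pos_def A" "k > 0"
  shows "pos_def (k *\<^sub>R A)"
  using assms unfolding pos_def_def
  by (simp add: scaleR_matrix_vector_assoc[symmetric] transpose_scalar)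

lemma matrix_diff_ldistrib:
  fixes A :: "real^'n^'m" and B C :: "real^'k^'n"
  shows "A ** (B - C) = A ** B - A ** C"
  by (simp add: matrix_matrix_mult_def vec_eq_iff right_diff_distrib sum_subtractf)

lemma matrix_diff_rdistrib:
  fixes A B :: "real^'n^'m" and C :: "real^'k^'n"
  shows "(A - B) ** C = A ** C - B ** C"
  by (simp add: matrix_matrix_mult_def vec_eq_iff left_diff_distrib sum_subtractf)

lemma transpose_diff:
  fixes A B :: "real^'n^'m"
  shows "transpose (A - B) = transpose A - transpose B"
  by (simp add: transpose_def vec_eq_iff)

section \<open>Upper-left blocks and vectors supported on the selected coordinates\<close>

lemma sum_supported_on_inj_range:
  fixes f :: "'p::finite \<Rightarrow> 'b::comm_monoid_add" and e :: "'q::finite \<Rightarrow> 'p"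
  assumes "inj e" "\<And>i. i \<notin> range e \<Longrightarrow> f i = 0"
  shows "(\<Sum>i\<in>UNIV. f i) = (\<Sum>j\<in>UNIV. f (e j))"
proof -
  have "(\<Sum>i\<in>UNIV. f i) = (\<Sum>i\<in>range e. f i)"
    using assms(2) by (intro sum.mono_neutral_right) auto
  then show ?thesis using assms(1) by (simp add: sum.reindex)
qed

lemma upper_left_block_quadratic_form:
  fixes A :: "real^'p^'p" and e :: "'q::finite \<Rightarrow> 'p"
  assumes e: "inj e" and x: "\<And>i. i \<notin> range e \<Longrightarrow> x $ i = 0"
  shows "x \<bullet> (A *v x) = (\<chi> j. x $ e j) \<bullet> (upper_left_block e A *v (\<chi> j. x $ e j))"
    and "x \<bullet> x = (\<chi> j. x $ e j) \<bullet> (\<chi> j. x $ e j)"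
proof -
  have "(A *v x) $ i = (\<Sum>j\<in>UNIV. A $ i $ e j * x $ e j)" for i
    unfolding matrix_vector_mult_def vec_lambda_beta
    by (rule sum_supported_on_inj_range[OF e]) (simp add: x)
  then show "x \<bullet> (A *v x) = (\<chi> j. x $ e j) \<bullet> (upper_left_block e A *v (\<chi> j. x $ e j))"
    unfolding inner_vec_def[of x]
    by (subst sum_supported_on_inj_range[OF e])
      (simp_all add: x inner_vec_def upper_left_block_def matrix_vector_mult_def)
  show "x \<bullet> x = (\<chi> j. x $ e j) \<bullet> (\<chi> j. x $ e j)"
    unfolding inner_vec_def[of x]
    by (subst sum_supported_on_inj_range[OF e]) (simp_all add: x inner_vec_def)
qed

lemma pos_def_upper_left_block:
  fixes A :: "real^'p^'p" and e :: "'q::finite \<Rightarrow> 'p"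
  assumes A: "pos_def A" and e: "inj e"
  shows "pos_def (upper_left_block e A)"
  unfolding pos_def_def
proof (intro conjI allI impI)
  have "A $ i $ j = A $ j $ i" for i j
    using pos_def_sym[OF A] by (metis transpose_def vec_lambda_beta)
  then show "transpose (upper_left_block e A) = upper_left_block e A"
    by (simp add: transpose_def upper_left_block_def vec_eq_iff)
  fix y :: "real^'q" assume y: "y \<noteq> 0"
  \<comment> \<open>Extending \<open>y\<close> by zero turns the form of the block into the form of
    \<open>A\<close>.\<close>
  define x :: "real^'p" where "x = (\<chi> i. if i \<in> range e then y $ inv e i else 0)"
  have xy: "(\<chi> j. x $ e j) = y" using e by (simp add: x_def vec_eq_iff)
  have x0: "x $ i = 0" if "i \<notin> range e" for i using that by (simp add: x_def)
  have "x \<noteq> 0"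
  proof
    assume "x = 0"
    then have "y = 0" by (simp add: xy[symmetric] vec_eq_iff)
    then show False using y by contradiction
  qed
  from pos_def_pos[OF A this] show "y \<bullet> (upper_left_block e A *v y) > 0"
    using upper_left_block_quadratic_form(1)[OF e x0, of A] xy by simp
qed

lemma trace_mult_block_id:
  fixes A :: "real^'p^'p" and e :: "'q::finite \<Rightarrow> 'p"
  assumes e: "inj e"
  shows "trace (A ** block_id e) = trace (upper_left_block e A)"
proof -
  have "(A ** block_id e) $ i $ i = (if i \<in> range e then A $ i $ i else 0)" for i
  proof -
    have "(A ** block_id e) $ i $ i = (\<Sum>k\<in>UNIV. if k = i then (if i \<in> range e then A $ i $ i else 0) else 0)"
      unfolding matrix_matrix_mult_def block_id_def vec_lambda_beta by (intro sum.cong) auto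
    then show ?thesis by simp
  qed
  then show ?thesis
    unfolding trace_def
    by (subst sum_supported_on_inj_range[OF e]) (simp_all add: upper_left_block_def)
qed

lemma block_id_fixed_vanishes:
  fixes x :: "real^'p"
  assumes "block_id e *v x = x" "i \<notin> range e"
  shows "x $ i = 0"
proof -
  have "(block_id e *v x) $ i = (\<Sum>j\<in>(UNIV :: 'p set). 0)"
    unfolding matrix_vector_mult_def block_id_def vec_lambda_beta
    by (intro sum.cong) (use assms(2) in auto)
  then show ?thesis using assms(1) by simp
qed

text \<open>Since \<open>T $ i\<close> is the i-th row of \<open>T\<close>, this matches entries of
  the covariance of a linear image with covariances of the linear forms given by the rows.\<close>

lemma matrix_triple_product_nth:
  fixes T :: "real^'n^'p" and \<Sigma> :: "real^'n^'n"
  shows "(T ** \<Sigma> ** transpose T) $ i $ j = T $ i \<bullet> (\<Sigma> *v T $ j)"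
proof -
  have "(T ** \<Sigma>) $ i = T $ i v* \<Sigma>"
    by (simp add: vec_eq_iff matrix_matrix_mult_def vector_matrix_mult_def mult.commute)
  moreover have "(T ** \<Sigma> ** transpose T) $ i $ j = (T ** \<Sigma>) $ i \<bullet> T $ j"
    by (simp add: matrix_matrix_mult_def[of "T ** \<Sigma>"] transpose_def inner_vec_def)
  ultimately show ?thesis by (simp only: dot_lmul_matrix)
qed

section \<open>Gaussian moments\<close>

text \<open>Serves for translations (completing the square), scalings by \<open>sqrt t\<close>, and
  the reflection at the origin.\<close>

lemma lborel_affine_euclidean_integral:
  fixes f :: "'a::euclidean_space \<Rightarrow> real"
  assumes f: "integrable lborel f" and c: "c \<noteq> 0"
  shows "integrable lborel (\<lambda>x. f (t + c *\<^sub>R x))"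
    and "(\<integral>x. f (t + c *\<^sub>R x) \<partial>lborel) = (\<integral>x. f x \<partial>lborel) / \<bar>c\<bar> ^ DIM('a)"
proof -
  let ?T = "\<lambda>x::'a. t + c *\<^sub>R x"
  have [measurable]: "f \<in> borel_measurable borel" using f by auto
  have eq: "lborel = density (distr lborel borel ?T) (\<lambda>_. ennreal (\<bar>c\<bar> ^ DIM('a)))"
    using lborel_affine[OF c, of t] by (simp add: ennreal_power)
  have "integrable (density (distr lborel borel ?T) (\<lambda>_. ennreal (\<bar>c\<bar> ^ DIM('a)))) f"
    using f eq by simp
  then have "integrable lborel (\<lambda>x. \<bar>c\<bar> ^ DIM('a) * f (?T x))"
    by (subst (asm) integrable_density) (auto simp: integrable_distr_eq)
  then show "integrable lborel (\<lambda>x. f (?T x))" using c by simp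
  have "(\<integral>x. f x \<partial>lborel) = (\<integral>x. f x \<partial>density (distr lborel borel ?T) (\<lambda>_. ennreal (\<bar>c\<bar> ^ DIM('a))))"
    using eq by simp
  also have "\<dots> = \<bar>c\<bar> ^ DIM('a) * (\<integral>x. f (?T x) \<partial>lborel)"
    by (subst integral_density) (auto simp: integral_distr)
  finally show "(\<integral>x. f (?T x) \<partial>lborel) = (\<integral>x. f x \<partial>lborel) / \<bar>c\<bar> ^ DIM('a)"
    using c by (simp add: field_simps)
qed

text \<open>The integrand is a product of one-dimensional kernels, each a multiple of a normal
  density.\<close>

lemma integrable_exp_neg_norm_square:
  assumes m: "m > 0"
  shows "integrable lborel (\<lambda>x::'a::euclidean_space. exp (- m * (x \<bullet> x)))"
proof (rule integrableI_bounded)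
  \<comment> \<open>Chosen so that the exponent of the normal density, with factor 1 / (2
    \<sigma>^2), has factor \<open>m\<close>.\<close>
  define \<sigma> where "\<sigma> = sqrt (1 / (2 * m))"
  have s: "\<sigma> > 0" "\<sigma>\<^sup>2 = 1 / (2 * m)" using m by (auto simp: \<sigma>_def)
  have "exp (- m * x\<^sup>2) = sqrt (2 * pi * \<sigma>\<^sup>2) * normal_density 0 \<sigma> x" for x
    using m by (simp add: normal_density_def s(2) field_simps)
  then have "integrable lborel (\<lambda>x::real. exp (- m * x\<^sup>2))"
    using s(1) by simp
  then have fin: "(\<integral>\<^sup>+x. ennreal (exp (- m * x\<^sup>2)) \<partial>lborel) < \<infinity>"
    by (subst (asm) integrable_iff_bounded) simp
  have "(\<integral>\<^sup>+x. ennreal (norm (exp (- m * (x \<bullet> x)))) \<partial>(lborel :: 'a measure))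
      = (\<integral>\<^sup>+x. (\<Prod>b\<in>Basis. ennreal (exp (- m * (x \<bullet> b)\<^sup>2))) \<partial>(lborel :: 'a measure))"
    by (intro nn_integral_cong, subst euclidean_inner)
      (simp add: prod_ennreal exp_sum[symmetric] sum_distrib_left power2_eq_square sum_negf)
  also have "\<dots> = (\<Prod>b\<in>(Basis::'a set). (\<integral>\<^sup>+x. ennreal (exp (- m * x\<^sup>2)) \<partial>lborel))"
    by (rule nn_integral_lborel_prod) auto
  also have "\<dots> < \<infinity>"
    using fin by (simp add: power_less_top_ennreal)
  finally show "(\<integral>\<^sup>+x. ennreal (norm (exp (- m * (x \<bullet> x)))) \<partial>(lborel :: 'a measure)) < \<infinity>" .
qed measurable

lemma borel_measurable_matrix_vector_mult [measurable (raw)]: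
  fixes B :: "real^'n^'m"
  assumes "f \<in> borel_measurable M" shows "(\<lambda>x. B *v f x) \<in> borel_measurable M"
  using assms by (rule borel_measurable_continuous_on[OF
      linear_continuous_on[OF matrix_vector_mul_bounded_linear]])

text \<open>The smallest eigenvalue of \<open>B\<close> yields a rotationally symmetric kernel as a
  majorant.\<close>

lemma gaussian_kernel_integrable:
  fixes B :: "real^'n^'n"
  assumes B: "pos_def B"
  shows "integrable lborel (\<lambda>x. exp (- (x \<bullet> (B *v x)) / 2))"
proof (rule Bochner_Integration.integrable_bound)
  have m: "ch_min B > 0"
    using Rayleigh_bounds(3) pos_def_sym pos_def_eigenvalue_pos B by blast
  then show "integrable lborel (\<lambda>x::real^'n. exp (- (ch_min B / 2) * (x \<bullet> x)))"
    by (intro integrable_exp_neg_norm_square) simp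
  show "AE x in lborel. norm (exp (- (x \<bullet> (B *v x)) / 2)) \<le> norm (exp (- (ch_min B / 2) * (x \<bullet> x)))"
    using Rayleigh_bounds(1)[OF pos_def_sym[OF B]] by auto
qed measurable

text \<open>Completing the square turns the factor \<open>exp (w \<bullet> x)\<close> into a translation of the kernel,
  so that the moments are obtained without a linear change of variables (which the library
  has only for well-ordered index types).\<close>

lemma gaussian_kernel_exp:
  fixes B :: "real^'n^'n" and w :: "real^'n"
  assumes B: "pos_def B"
  defines "\<And>x. K x \<equiv> exp (- (x \<bullet> (B *v x)) / 2)"
  shows "integrable lborel (\<lambda>x. K x * exp (w \<bullet> x))"
    and "(\<integral>x. K x * exp (w \<bullet> x) \<partial>lborel) = exp (w \<bullet> (matrix_inv B *v w) / 2) * (\<integral>x. K x \<partial>lborel)"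
proof -
  \<comment> \<open>The centre of the completed square: x'Bx - 2 w'x = (x - v)'B(x - v) -
    w'v.\<close>
  define v where "v = matrix_inv B *v w"
  have Bv: "B *v v = w"
    by (simp add: v_def matrix_vector_mul_assoc matrix_inv_mult pos_def_invertible[OF B])
  have "v \<bullet> (B *v x) = w \<bullet> x" for x
    using pos_def_sym[OF B] by (simp add: inner_matrix_vector_transpose Bv)
  then have q: "((- v + 1 *\<^sub>R x) \<bullet> (B *v (- v + 1 *\<^sub>R x))) = x \<bullet> (B *v x) - 2 * (w \<bullet> x) + w \<bullet> v" for x
    by (simp add: matrix_vector_mult_diff_distrib inner_diff_left inner_diff_right Bv inner_commute)
  have eq: "K x * exp (w \<bullet> x) = exp (w \<bullet> v / 2) * K (- v + 1 *\<^sub>R x)" for x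
    unfolding K_def mult_exp_exp q by (simp add: field_simps)
  have "integrable lborel K" unfolding K_def by (rule gaussian_kernel_integrable[OF B])
  note tr = lborel_affine_euclidean_integral[OF this, of 1 "- v"]
  show "integrable lborel (\<lambda>x. K x * exp (w \<bullet> x))"
    unfolding eq using tr(1) by simp
  show "(\<integral>x. K x * exp (w \<bullet> x) \<partial>lborel) = exp (w \<bullet> (matrix_inv B *v w) / 2) * (\<integral>x. K x \<partial>lborel)"
    unfolding eq using tr(2) by (simp add: v_def)
qed

section \<open>Second moments of Gaussian kernels by second differences\<close>

lemma sinh_superadditive:
  assumes "x \<ge> 0" shows "real n * sinh x \<le> sinh (real n * x)"
proof (induction n)
  case (Suc n)
  have "sinh (real n * x) * 1 + 1 * sinh x \<le> sinh (real n * x) * cosh x + cosh (real n * x) * sinh x"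
    using assms by (intro add_mono mult_mono cosh_real_ge_1) auto
  then show ?case using Suc by (simp add: sinh_add algebra_simps)
qed simp

text \<open>Provides a majorant independent of \<open>n\<close> for dominated convergence. With N =
  \<open>Suc n\<close>, superadditivity of sinh on the nonnegative axis moves N inside, and 4
  sinh(u/2)^2 = exp u + exp (-u) - 2.\<close>

lemma scaled_sinh_square_bound:
  fixes u :: real
  shows "(2 * real (Suc n) * sinh (u / (2 * real (Suc n))))\<^sup>2 \<le> exp u + exp (- u)"
proof -
  define x where "x = \<bar>u\<bar> / (2 * real (Suc n))"
  have "(sinh (u / (2 * real (Suc n))))\<^sup>2 = (sinh x)\<^sup>2"
    by (cases "u \<ge> 0") (auto simp: x_def)
  then have "(2 * real (Suc n) * sinh (u / (2 * real (Suc n))))\<^sup>2 = 4 * (real (Suc n) * sinh x)\<^sup>2"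
    by (simp only: power_mult_distrib) (simp add: power_mult_distrib)
  also have "\<dots> \<le> 4 * (sinh (real (Suc n) * x))\<^sup>2"
    by (intro mult_left_mono power_mono sinh_superadditive) (auto simp: x_def)
  also have "real (Suc n) * x = \<bar>u\<bar> / 2" unfolding x_def by (simp del: of_nat_Suc)
  also have "4 * (sinh (\<bar>u\<bar> / 2))\<^sup>2 = exp u + exp (- u) - 2"
    by (cases "u \<ge> 0")
      (simp_all add: sinh_field_def power2_eq_square field_simps exp_add[symmetric])
  finally show ?thesis by simp
qed

lemma scaled_sinh_tendsto:
  "(\<lambda>n. 2 * real (Suc n) * sinh (u / (2 * real (Suc n)))) \<longlonglongrightarrow> (u::real)"
  by real_asymp

lemma scaled_exp_tendsto:
  "(\<lambda>n. 2 * (real (Suc n))\<^sup>2 * (exp (c / (2 * (real (Suc n))\<^sup>2)) - 1)) \<longlonglongrightarrow> (c::real)"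
  by real_asymp

text \<open>The second moment is a second derivative at 0 of the Laplace transform found in
  \<open>gaussian_kernel_exp\<close>. Instead of differentiating under the integral, symmetric
  second differences with step 1/N are integrated in closed form, and N tends to infinity by
  dominated convergence.\<close>

lemma gaussian_kernel_second_moment:
  fixes B :: "real^'n^'n" and w :: "real^'n"
  assumes B: "pos_def B"
  defines "\<And>x. K x \<equiv> exp (- (x \<bullet> (B *v x)) / 2)"
  shows "integrable lborel (\<lambda>x. (w \<bullet> x)\<^sup>2 * K x)"
    and "(\<integral>x. (w \<bullet> x)\<^sup>2 * K x \<partial>lborel) = (w \<bullet> (matrix_inv B *v w)) * (\<integral>x. K x \<partial>lborel)"
proof -
  \<comment> \<open>With N = \<open>Suc n\<close> and s = \<open>w \<bullet> x\<close>, the squared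
    factor equals N^2 (exp (s/N) + exp (-s/N) - 2). Using \<open>Suc n\<close> keeps the step finite
    from the start.\<close>
  define F where "F n x = (2 * real (Suc n) * sinh ((w \<bullet> x) / (2 * real (Suc n))))\<^sup>2 * K x" for n x
  have [measurable]: "K \<in> borel_measurable borel" unfolding K_def by measurable
  have "continuous_on UNIV (sinh :: real \<Rightarrow> real)" by (intro continuous_intros)
  then have [measurable]: "(sinh :: real \<Rightarrow> real) \<in> borel_measurable borel"
    by (rule borel_measurable_continuous_onI)
  have meas: "F n \<in> borel_measurable lborel" "(\<lambda>x. (w \<bullet> x)\<^sup>2 * K x) \<in> borel_measurable lborel" for n
    unfolding F_def by measurable
  note E = gaussian_kernel_exp[OF B, folded K_def]
  have dom: "integrable lborel (\<lambda>x. K x * exp (w \<bullet> x) + K x * exp ((- w) \<bullet> x))"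
    by (intro Bochner_Integration.integrable_add E)
  have lim: "AE x in lborel. (\<lambda>n. F n x) \<longlonglongrightarrow> (w \<bullet> x)\<^sup>2 * K x"
    unfolding F_def by (intro AE_I2 tendsto_intros scaled_sinh_tendsto)
  have bnd: "AE x in lborel. norm (F n x) \<le> K x * exp (w \<bullet> x) + K x * exp ((- w) \<bullet> x)" for n
  proof (intro AE_I2)
    fix x
    have "norm (F n x) = (2 * real (Suc n) * sinh ((w \<bullet> x) / (2 * real (Suc n))))\<^sup>2 * K x"
      by (simp add: F_def K_def abs_mult)
    also have "\<dots> \<le> (exp (w \<bullet> x) + exp (- (w \<bullet> x))) * K x"
      by (intro mult_right_mono scaled_sinh_square_bound) (simp add: K_def)
    finally show "norm (F n x) \<le> K x * exp (w \<bullet> x) + K x * exp ((- w) \<bullet> x)"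
      by (simp add: algebra_simps)
  qed
  show "integrable lborel (\<lambda>x. (w \<bullet> x)\<^sup>2 * K x)"
    by (rule integrable_dominated_convergence[OF meas(2,1) dom lim bnd])
  have "(\<lambda>n. \<integral>x. F n x \<partial>lborel) \<longlonglongrightarrow> (\<integral>x. (w \<bullet> x)\<^sup>2 * K x \<partial>lborel)"
    by (rule integral_dominated_convergence[OF meas(2,1) dom lim bnd])
  moreover have "(\<integral>x. F n x \<partial>lborel) =
      2 * (real (Suc n))\<^sup>2 * (exp ((w \<bullet> (matrix_inv B *v w)) / (2 * (real (Suc n))\<^sup>2)) - 1) * (\<integral>x. K x \<partial>lborel)" for n
  proof -
    define N where "N = real (Suc n)"
    have N: "N > 0" by (simp add: N_def)
    define u where "u = (1 / N) *\<^sub>R w"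
    have sinh_sq: "4 * (sinh (y / (2 * N)))\<^sup>2 = exp (y / N) + exp (- (y / N)) - 2" for y
      using N by (simp add: sinh_field_def power2_eq_square field_simps exp_add[symmetric])
    have "F n x = N\<^sup>2 * (4 * (sinh ((w \<bullet> x) / (2 * N)))\<^sup>2) * K x" for x
      unfolding F_def N_def[symmetric] power_mult_distrib by simp
    then have "F n x = N\<^sup>2 * (K x * exp (u \<bullet> x) + K x * exp ((- u) \<bullet> x) - 2 * K x)" for x
      unfolding sinh_sq u_def by (simp add: algebra_simps)
    then have "(\<integral>x. F n x \<partial>lborel) = N\<^sup>2 * (exp (u \<bullet> (matrix_inv B *v u) / 2) * (\<integral>x. K x \<partial>lborel) +
        exp ((- u) \<bullet> (matrix_inv B *v (- u)) / 2) * (\<integral>x. K x \<partial>lborel) - 2 * (\<integral>x. K x \<partial>lborel))"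
      using E[of u] E[of "- u"] gaussian_kernel_integrable[OF B, folded K_def] by simp
    also have "(- u) \<bullet> (matrix_inv B *v (- u)) = u \<bullet> (matrix_inv B *v u)"
      using matrix_vector_mult_scaleR[of "matrix_inv B" "- 1" u] by simp
    also have "u \<bullet> (matrix_inv B *v u) / 2 = (w \<bullet> (matrix_inv B *v w)) / (2 * N\<^sup>2)"
      by (simp add: u_def matrix_vector_mult_scaleR power2_eq_square)
    finally show ?thesis unfolding N_def by (simp add: algebra_simps)
  qed
  ultimately show "(\<integral>x. (w \<bullet> x)\<^sup>2 * K x \<partial>lborel) = (w \<bullet> (matrix_inv B *v w)) * (\<integral>x. K x \<partial>lborel)"
    by (intro LIMSEQ_unique[where X = "\<lambda>n. \<integral>x. F n x \<partial>lborel"])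
      (simp_all only:, intro tendsto_intros scaled_exp_tendsto)
qed

section \<open>Normal densities under scaling, and their scale mixtures\<close>

lemma gaussian_kernel_scale:
  fixes B :: "real^'n^'n"
  assumes "pos_def B" "t > 0"
  shows "(\<integral>x. exp (- (t * (x \<bullet> (B *v x))) / 2) \<partial>lborel)
       = (\<integral>x. exp (- (x \<bullet> (B *v x)) / 2) \<partial>lborel) / sqrt t ^ CARD('n)"
  using lborel_affine_euclidean_integral(2)[OF gaussian_kernel_integrable[OF assms(1)], of "sqrt t" 0] assms(2)
  by (simp add: matrix_vector_mult_scaleR mult.assoc[symmetric])

text \<open>Makes the dependence on \<open>t\<close> explicit, without determinant or inverse of a
  varying matrix. This gives joint measurability in \<open>t\<close> and \<open>x\<close>, needed
  for Fubini.\<close>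

lemma mvn_density_scaled:
  fixes \<Sigma> :: "real^'n^'n"
  assumes S: "pos_def \<Sigma>" and t: "t > 0"
  shows "mvn_density 0 ((1 / t) *\<^sub>R \<Sigma>) x =
    (2 * pi) powr (- real CARD('n) / 2) * det \<Sigma> powr (- 1 / 2) * sqrt t ^ CARD('n) *
      exp (- (t * (x \<bullet> (matrix_inv \<Sigma> *v x))) / 2)"
proof -
  let ?y = "sqrt t ^ CARD('n)"
  have "?y\<^sup>2 = t ^ CARD('n)"
    using t by (metis less_imp_le mult.commute power_mult real_sqrt_pow2)
  then have "(1 / t) ^ CARD('n) = ?y powr (- 2)"
    using t by (simp add: powr_minus_divide power_one_over)
  then have "((1 / t) ^ CARD('n)) powr (- 1 / 2) = ?y"
    using t by (simp add: powr_powr)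
  then have "det ((1 / t) *\<^sub>R \<Sigma>) powr (- 1 / 2) = sqrt t ^ CARD('n) * det \<Sigma> powr (- 1 / 2)"
    using t pos_def_det_nonneg[OF S] unfolding det_scaleR by (subst powr_mult) auto
  moreover have "matrix_inv ((1 / t) *\<^sub>R \<Sigma>) = t *\<^sub>R matrix_inv \<Sigma>"
    using matrix_inv_scaleR[OF pos_def_invertible[OF S], of "1 / t"] t by simp
  ultimately show ?thesis
    by (simp add: mvn_density_def scaleR_matrix_vector_assoc[symmetric])
qed

text \<open>The power of \<open>sqrt t\<close> in the norming factor cancels the one from rescaling
  the variable.\<close>

lemma mvn_density_total:
  fixes \<Sigma> :: "real^'n^'n"
  assumes S: "pos_def \<Sigma>" and t: "t > 0"
  shows "integrable lborel (mvn_density 0 ((1 / t) *\<^sub>R \<Sigma>))"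
    and "(\<integral>x. mvn_density 0 ((1 / t) *\<^sub>R \<Sigma>) x \<partial>lborel) = (\<integral>x. mvn_density 0 \<Sigma> x \<partial>lborel)"
proof -
  have "pos_def ((1 / t) *\<^sub>R \<Sigma>)" using S t by (simp add: pos_def_scaleR)
  from gaussian_kernel_integrable[OF pos_def_matrix_inv[OF this]]
  show "integrable lborel (mvn_density 0 ((1 / t) *\<^sub>R \<Sigma>))"
    by (simp add: mvn_density_def[abs_def])
  show "(\<integral>x. mvn_density 0 ((1 / t) *\<^sub>R \<Sigma>) x \<partial>lborel) = (\<integral>x. mvn_density 0 \<Sigma> x \<partial>lborel)"
    unfolding mvn_density_scaled[OF S t] integral_mult_right_zero
      gaussian_kernel_scale[OF pos_def_matrix_inv[OF S] t]
    using t by (simp add: mvn_density_def)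
qed

text \<open>Expressed relative to the total mass, whose value is not computed here.\<close>

lemma mvn_density_second_moment:
  fixes \<Sigma> :: "real^'n^'n"
  assumes S: "pos_def \<Sigma>"
  shows "integrable lborel (\<lambda>x. (a \<bullet> x)\<^sup>2 * mvn_density 0 \<Sigma> x)"
    and "(\<integral>x. (a \<bullet> x)\<^sup>2 * mvn_density 0 \<Sigma> x \<partial>lborel) =
      (a \<bullet> (\<Sigma> *v a)) * (\<integral>x. mvn_density 0 \<Sigma> x \<partial>lborel)"
proof -
  define c where "c = (2 * pi) powr (- real CARD('n) / 2) * det \<Sigma> powr (- 1 / 2)"
  have d: "mvn_density 0 \<Sigma> x = c * exp (- (x \<bullet> (matrix_inv \<Sigma> *v x)) / 2)" for x
    by (simp add: mvn_density_def c_def)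
  have ii: "matrix_inv (matrix_inv \<Sigma>) = \<Sigma>"
    by (intro matrix_inv_unique matrix_inv_mult pos_def_invertible S)
  note m = gaussian_kernel_second_moment[OF pos_def_matrix_inv[OF S], of a, unfolded ii]
  show "integrable lborel (\<lambda>x. (a \<bullet> x)\<^sup>2 * mvn_density 0 \<Sigma> x)"
    unfolding d mult.left_commute[of _ c] using m(1) by simp
  show "(\<integral>x. (a \<bullet> x)\<^sup>2 * mvn_density 0 \<Sigma> x \<partial>lborel) =
      (a \<bullet> (\<Sigma> *v a)) * (\<integral>x. mvn_density 0 \<Sigma> x \<partial>lborel)"
    unfolding d mult.left_commute[of _ c] using m(2) by simp
qed

text \<open>Fubini: for positive \<open>t\<close> the integrand is nonnegative, so its inner
  absolute integral is \<open>r t\<close>, and integrability of \<open>r\<close> gives integrability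
  on the product space.\<close>

lemma mixture_integral:
  fixes h :: "'b::euclidean_space \<Rightarrow> real" and G :: "real \<Rightarrow> 'b \<Rightarrow> real"
  assumes N: "finite_measure N" "sets N = sets (restrict_space borel {0<..})"
    and G[measurable]: "case_prod G \<in> borel_measurable (borel \<Otimes>\<^sub>M borel)"
    and h[measurable]: "h \<in> borel_measurable borel"
    and pos: "\<And>x. h x \<ge> 0" "\<And>t x. t > 0 \<Longrightarrow> G t x \<ge> 0"
    and int: "\<And>t. t > 0 \<Longrightarrow> integrable lborel (\<lambda>x. h x * G t x)"
    and eq: "\<And>t. t > 0 \<Longrightarrow> (\<integral>x. h x * G t x \<partial>lborel) = r t"
    and r: "integrable N r"
  shows "integrable lborel (\<lambda>x. h x * (LINT t|N. G t x))"
    and "(\<integral>x. h x * (LINT t|N. G t x) \<partial>lborel) = (LINT t|N. r t)"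
proof -
  have sp: "space N = {0<..}" using sets_eq_imp_space_eq[OF N(2)] by simp
  interpret N: finite_measure N by fact
  interpret P: pair_sigma_finite N lborel ..
  have [measurable]: "(\<lambda>t. t) \<in> N \<rightarrow>\<^sub>M borel"
    using N(2) by (simp add: measurable_restrict_space1 cong: measurable_cong_sets)
  have meas: "(\<lambda>(t, x). h x * G t x) \<in> borel_measurable (N \<Otimes>\<^sub>M lborel)"
  proof -
    \<comment> \<open>\<open>N\<close> lives on the restricted sigma-algebra of the positive
      half-line, so measurability is pulled back along the inclusion.\<close>
    have "(\<lambda>p. (fst p, snd p)) \<in> N \<Otimes>\<^sub>M lborel \<rightarrow>\<^sub>M (borel \<Otimes>\<^sub>M borel :: (real \<times> 'b) measure)"
      by measurable
    from measurable_compose[OF this G] show ?thesis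
      by (simp add: case_prod_beta')
  qed
  have "integrable (N \<Otimes>\<^sub>M lborel) (\<lambda>(t, x). h x * G t x)"
  proof (rule P.Fubini_integrable[OF meas])
    show "AE t in N. integrable lborel (\<lambda>x. (\<lambda>(t, x). h x * G t x) (t, x))"
      using int sp by (auto intro!: AE_I2)
    have "(\<integral>x. norm ((\<lambda>(t, x). h x * G t x) (t, x)) \<partial>lborel) = r t" if "t \<in> space N" for t
      using that sp pos eq[of t] by (simp add: abs_mult)
    then show "integrable N (\<lambda>t. \<integral>x. norm ((\<lambda>(t, x). h x * G t x) (t, x)) \<partial>lborel)"
      using r by (simp cong: Bochner_Integration.integrable_cong)
  qed
  note F = P.integrable_snd[OF this] P.Fubini_integral[OF this]
  show "integrable lborel (\<lambda>x. h x * (LINT t|N. G t x))" using F(1) by simp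
  have "(\<integral>x. h x * (LINT t|N. G t x) \<partial>lborel) = (LINT t|N. (\<integral>x. h x * G t x \<partial>lborel))"
    using F(2) by simp
  also have "\<dots> = (LINT t|N. r t)"
    using sp eq by (intro Bochner_Integration.integral_cong) auto
  finally show "(\<integral>x. h x * (LINT t|N. G t x) \<partial>lborel) = (LINT t|N. r t)" .
qed

text \<open>Two cases of \<open>mixture_integral\<close>: weight 1 with constant inner integral
  \<kappa>, and weight \<open>(a \<bullet> x)\<^sup>2\<close> with an inner integral proportional to
  1/t. The result is meant for each half of a Jordan decomposition separately.\<close>

lemma mvn_mixture_moments:
  fixes \<Sigma> :: "real^'n^'n"
  assumes S: "pos_def \<Sigma>"
    and N: "finite_measure N" "sets N = sets (restrict_space borel {0<..})"
    and r: "integrable N (\<lambda>t. 1 / t)"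
  defines "F \<equiv> \<lambda>x. LINT t|N. mvn_density 0 ((1 / t) *\<^sub>R \<Sigma>) x"
    and "\<kappa> \<equiv> \<integral>x. mvn_density 0 \<Sigma> x \<partial>lborel"
  shows "integrable lborel F" "(\<integral>x. F x \<partial>lborel) = \<kappa> * (LINT t|N. 1)"
    "integrable lborel (\<lambda>x. (a \<bullet> x)\<^sup>2 * F x)"
    "(\<integral>x. (a \<bullet> x)\<^sup>2 * F x \<partial>lborel) = \<kappa> * (a \<bullet> (\<Sigma> *v a)) * (LINT t|N. 1 / t)"
proof -
  \<comment> \<open>Agrees with the density for positive \<open>t\<close>, but is a jointly
    measurable formula on the whole line.\<close>
  define G where "G t x = (2 * pi) powr (- real CARD('n) / 2) * det \<Sigma> powr (- 1 / 2) *
      sqrt t ^ CARD('n) * exp (- (t * (x \<bullet> (matrix_inv \<Sigma> *v x))) / 2)" for t x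
  have G: "mvn_density 0 ((1 / t) *\<^sub>R \<Sigma>) x = G t x" if "t > 0" for t x
    using mvn_density_scaled[OF S that] by (simp add: G_def)
  have sp: "space N = {0<..}" using sets_eq_imp_space_eq[OF N(2)] by simp
  have F: "F x = (LINT t|N. G t x)" for x
    unfolding F_def using sp G by (intro Bochner_Integration.integral_cong) auto
  interpret N: finite_measure N by fact
  have Gm: "case_prod G \<in> borel_measurable (borel \<Otimes>\<^sub>M borel)"
    unfolding G_def by measurable
  have pos: "G t x \<ge> 0" if "t > 0" for t x
    using that by (simp add: G_def)
  have tot: "integrable lborel (\<lambda>x. 1 * G t x)" "(\<integral>x. 1 * G t x \<partial>lborel) = \<kappa>" if "t > 0" for t
    using mvn_density_total[OF S that] ext[of "mvn_density 0 ((1 / t) *\<^sub>R \<Sigma>)" "G t", OF G[OF that]] by (simp_all add: \<kappa>_def)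
  have sec: "integrable lborel (\<lambda>x. (a \<bullet> x)\<^sup>2 * G t x)"
    "(\<integral>x. (a \<bullet> x)\<^sup>2 * G t x \<partial>lborel) = \<kappa> * (a \<bullet> (\<Sigma> *v a)) * (1 / t)" if "t > 0" for t
    using mvn_density_second_moment[OF pos_def_scaleR[OF S], of "1 / t" a]
      mvn_density_total(2)[OF S that] G[OF that] that
    by (simp_all add: \<kappa>_def scaleR_matrix_vector_assoc[symmetric])
  from mixture_integral[OF N Gm _ _ pos tot]
  show "integrable lborel F" "(\<integral>x. F x \<partial>lborel) = \<kappa> * (LINT t|N. 1)"
    by (simp_all add: F[abs_def] mult.commute)
  have "integrable N (\<lambda>t. \<kappa> * (a \<bullet> (\<Sigma> *v a)) * (1 / t))"
    by (intro integrable_mult_right r)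
  from mixture_integral[OF N Gm _ _ pos sec this]
  show "integrable lborel (\<lambda>x. (a \<bullet> x)\<^sup>2 * F x)"
    "(\<integral>x. (a \<bullet> x)\<^sup>2 * F x \<partial>lborel) = \<kappa> * (a \<bullet> (\<Sigma> *v a)) * (LINT t|N. 1 / t)"
    unfolding F integral_mult_right_zero by simp_all
qed

section \<open>Moments of the error vector\<close>

lemma elliptical_density_even:
  "elliptical_density 0 \<Sigma> g (- x) = elliptical_density 0 \<Sigma> g x"
  using matrix_vector_mult_scaleR[of "matrix_inv \<Sigma>" "- 1" x]
  by (simp add: elliptical_density_def)

text \<open>Fubini is applied to \<open>\<nu>p\<close> and \<open>\<nu>m\<close> separately and the
  results are subtracted, so a signed mixing measure causes no difficulty.\<close>

lemma elliptical_mixture_moments: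
  fixes \<epsilon> :: "'a \<Rightarrow> real^'n" and \<Sigma> :: "real^'n^'n"
  assumes M: "prob_space M" and S: "pos_def \<Sigma>"
    and ell: "elliptically_distributed M \<epsilon> 0 \<Sigma> g"
    and Np: "finite_measure \<nu>p" "sets \<nu>p = sets (restrict_space borel {0<..})" "integrable \<nu>p (\<lambda>t. 1 / t)"
    and Nm: "finite_measure \<nu>m" "sets \<nu>m = sets (restrict_space borel {0<..})" "integrable \<nu>m (\<lambda>t. 1 / t)"
    and one: "signed_integral \<nu>p \<nu>m (\<lambda>t. 1) = 1"
    and mix: "AE x in lborel. elliptical_density 0 \<Sigma> g x =
           signed_integral \<nu>p \<nu>m (\<lambda>t. mvn_density 0 ((1 / t) *\<^sub>R \<Sigma>) x)"
  defines "s \<equiv> signed_integral \<nu>p \<nu>m (\<lambda>t. 1 / t)"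
  shows "s > 0"
    and "integrable M (\<lambda>\<omega>. (a \<bullet> \<epsilon> \<omega>) * (b \<bullet> \<epsilon> \<omega>))"
    and "(LINT \<omega>|M. (a \<bullet> \<epsilon> \<omega>) * (b \<bullet> \<epsilon> \<omega>)) = s * (a \<bullet> (\<Sigma> *v b))"
    and "integrable M (\<lambda>\<omega>. a \<bullet> \<epsilon> \<omega>)"
    and "(LINT \<omega>|M. a \<bullet> \<epsilon> \<omega>) = 0"
proof -
  interpret prob_space M by fact
  define f where "f = elliptical_density 0 \<Sigma> g"
  define Fp where "Fp x = (LINT t|\<nu>p. mvn_density 0 ((1 / t) *\<^sub>R \<Sigma>) x)" for x
  define Fm where "Fm x = (LINT t|\<nu>m. mvn_density 0 ((1 / t) *\<^sub>R \<Sigma>) x)" for x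
  define \<kappa> where "\<kappa> = (\<integral>x. mvn_density 0 \<Sigma> x \<partial>lborel)"
  note P = mvn_mixture_moments[OF S Np, folded Fp_def \<kappa>_def]
  note Q = mvn_mixture_moments[OF S Nm, folded Fm_def \<kappa>_def]
  have mix': "AE x in lborel. f x = Fp x - Fm x"
    using mix by (simp add: f_def signed_integral_def Fp_def Fm_def)
  have f0: "f x \<ge> 0" for x
  proof -
    have "x \<bullet> (matrix_inv \<Sigma> *v x) \<ge> 0"
      using pos_def_pos[OF pos_def_matrix_inv[OF S], of x] by (cases "x = 0") auto
    then show ?thesis using ell by (simp add: f_def elliptical_density_def elliptically_distributed_def)
  qed
  have dist: "distributed M lborel \<epsilon> (\<lambda>x. ennreal (f x))"
    using ell by (simp add: elliptically_distributed_def f_def)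
  have [measurable]: "f \<in> borel_measurable borel"
    using distributed_real_measurable[OF _ dist] f0 by simp
  have [measurable]: "\<epsilon> \<in> borel_measurable M"
    using distributed_measurable[OF dist] by simp
  have [measurable]: "Fp \<in> borel_measurable borel" "Fm \<in> borel_measurable borel"
    using P(1) Q(1) by auto
  have Ef: "(\<integral>x. f x * h x \<partial>lborel) = (LINT \<omega>|M. h (\<epsilon> \<omega>))" if "h \<in> borel_measurable borel" for h
    using distributed_integral[OF dist, of h] that f0 by simp
  have If: "integrable lborel (\<lambda>x. f x * h x) \<longleftrightarrow> integrable M (\<lambda>\<omega>. h (\<epsilon> \<omega>))"
    if "h \<in> borel_measurable borel" for h
    using distributed_integrable[OF dist, of h] that f0 by simp
  have total: "(\<integral>x. f x \<partial>lborel) = 1" "integrable lborel f"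
    using Ef[of "\<lambda>_. 1"] If[of "\<lambda>_. 1"] by (simp_all add: prob_space)
  \<comment> \<open>A second evaluation of the total mass, which fixes the norming constant
    \<kappa>.\<close>
  have "(\<integral>x. f x \<partial>lborel) = (\<integral>x. Fp x - Fm x \<partial>lborel)"
    using mix' by (intro integral_cong_AE) auto
  also have "\<dots> = \<kappa> * (LINT t|\<nu>p. 1) - \<kappa> * (LINT t|\<nu>m. 1)"
    using P(1,2) Q(1,2) by simp
  also have "\<dots> = \<kappa>"
    using one unfolding signed_integral_def by (simp add: right_diff_distrib[symmetric])
  finally have \<kappa>: "\<kappa> = 1" using total by simp
  have sq: "integrable M (\<lambda>\<omega>. (a \<bullet> \<epsilon> \<omega>)\<^sup>2)" "(LINT \<omega>|M. (a \<bullet> \<epsilon> \<omega>)\<^sup>2) = s * (a \<bullet> (\<Sigma> *v a))" for a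
  proof -
    have eq: "AE x in lborel. f x * (a \<bullet> x)\<^sup>2 = (a \<bullet> x)\<^sup>2 * Fp x - (a \<bullet> x)\<^sup>2 * Fm x"
      using mix' by eventually_elim (simp add: left_diff_distrib mult.commute)
    have "integrable lborel (\<lambda>x. (a \<bullet> x)\<^sup>2 * Fp x - (a \<bullet> x)\<^sup>2 * Fm x)"
      using P(3) Q(3) by (rule Bochner_Integration.integrable_diff)
    then have "integrable lborel (\<lambda>x. f x * (a \<bullet> x)\<^sup>2)"
      using eq by (subst integrable_cong_AE) auto
    then show "integrable M (\<lambda>\<omega>. (a \<bullet> \<epsilon> \<omega>)\<^sup>2)"
      by (subst (asm) If) auto
    have "(LINT \<omega>|M. (a \<bullet> \<epsilon> \<omega>)\<^sup>2) = (\<integral>x. f x * (a \<bullet> x)\<^sup>2 \<partial>lborel)"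
      by (subst Ef) auto
    also have "\<dots> = (\<integral>x. (a \<bullet> x)\<^sup>2 * Fp x - (a \<bullet> x)\<^sup>2 * Fm x \<partial>lborel)"
      using eq by (intro integral_cong_AE) auto
    also have "\<dots> = s * (a \<bullet> (\<Sigma> *v a))"
      unfolding s_def signed_integral_def using P(3,4)[of a] Q(3,4)[of a] \<kappa>
      by (simp add: algebra_simps)
    finally show "(LINT \<omega>|M. (a \<bullet> \<epsilon> \<omega>)\<^sup>2) = s * (a \<bullet> (\<Sigma> *v a))" .
  qed
  \<comment> \<open>Polarization reduces mixed moments to squares of single linear forms.\<close>
  have pol: "(a \<bullet> e) * (b \<bullet> e) = (((a + b) \<bullet> e)\<^sup>2 - ((a - b) \<bullet> e)\<^sup>2) / 4" for e
    by (simp add: inner_add_left inner_diff_left power2_eq_square algebra_simps)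
  have sym: "b \<bullet> (\<Sigma> *v a) = a \<bullet> (\<Sigma> *v b)"
    using pos_def_sym[OF S] by (metis inner_commute inner_matrix_vector_transpose)
  show "integrable M (\<lambda>\<omega>. (a \<bullet> \<epsilon> \<omega>) * (b \<bullet> \<epsilon> \<omega>))"
    unfolding pol using sq(1) by simp
  show "(LINT \<omega>|M. (a \<bullet> \<epsilon> \<omega>) * (b \<bullet> \<epsilon> \<omega>)) = s * (a \<bullet> (\<Sigma> *v b))"
    unfolding pol using sq[of "a + b"] sq[of "a - b"] sym
    by (simp add: matrix_vector_right_distrib matrix_vector_mult_diff_distrib inner_add_left
        inner_add_right inner_diff_left inner_diff_right algebra_simps)
  show int: "integrable M (\<lambda>\<omega>. a \<bullet> \<epsilon> \<omega>)"
  proof (rule Bochner_Integration.integrable_bound)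
    show "integrable M (\<lambda>\<omega>. 1 + (a \<bullet> \<epsilon> \<omega>)\<^sup>2)" using sq(1) by simp
    \<comment> \<open>On a probability space a finite second moment bounds the first.\<close>
    have "\<bar>u\<bar> \<le> 1 + u\<^sup>2" for u :: real
      using zero_le_power2[of "\<bar>u\<bar> - 1"] zero_le_power2[of u] by (simp add: power2_diff)
    then show "AE \<omega> in M. norm (a \<bullet> \<epsilon> \<omega>) \<le> norm (1 + (a \<bullet> \<epsilon> \<omega>)\<^sup>2)"
      by (intro AE_I2) simp
  qed measurable
  \<comment> \<open>The density is even and the linear form is odd, so reflection changes the sign
    of the integral.\<close>
  have "(\<integral>x. f x * (a \<bullet> x) \<partial>lborel) = (\<integral>x. f (- x) * (a \<bullet> (- x)) \<partial>lborel)"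
    using lborel_affine_euclidean_integral(2)[of "\<lambda>x. f x * (a \<bullet> x)" "- 1" 0] int by (simp add: If)
  also have "\<dots> = - (\<integral>x. f x * (a \<bullet> x) \<partial>lborel)"
    by (simp add: f_def elliptical_density_even)
  finally have "(\<integral>x. f x * (a \<bullet> x) \<partial>lborel) = 0" by simp
  then show "(LINT \<omega>|M. a \<bullet> \<epsilon> \<omega>) = 0" by (simp add: Ef)
  \<comment> \<open>Positivity is not visible from the signed integral. Otherwise the second moment
    of a nonzero linear form \<open>c\<close> would be at most 0, so \<open>f\<close> would vanish
    almost everywhere off the null set \<open>c \<bullet> x = 0\<close>, against total mass
    1.\<close>
  show "s > 0"
  proof (rule ccontr)
    assume "\<not> s > 0"
    define c :: "real^'n" where "c = axis undefined 1"
    have c: "c \<noteq> 0" by (simp add: c_def axis_eq_0_iff)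
    have "(\<integral>x. f x * (c \<bullet> x)\<^sup>2 \<partial>lborel) = s * (c \<bullet> (\<Sigma> *v c))"
      using sq(2)[of c] by (simp add: Ef)
    also have "\<dots> \<le> 0"
      using \<open>\<not> s > 0\<close> pos_def_pos[OF S c] by (simp add: mult_le_0_iff)
    finally have "(\<integral>x. f x * (c \<bullet> x)\<^sup>2 \<partial>lborel) = 0"
      using f0 by (intro antisym) (auto intro!: integral_nonneg_AE)
    then have "AE x in lborel. f x * (c \<bullet> x)\<^sup>2 = 0"
      using f0 sq(1)[of c] by (subst (asm) integral_nonneg_eq_0_iff_AE) (auto simp: If)
    moreover have "AE x in lborel. c \<bullet> x \<noteq> 0"
    proof -
      have "{x. c \<bullet> x = 0} \<in> null_sets lebesgue"
        using negligible_hyperplane[of c 0] c by (simp add: negligible_iff_null_sets)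
      then have "AE x in lebesgue. x \<notin> {x. c \<bullet> x = 0}" by (rule AE_not_in)
      then show ?thesis by (simp add: AE_completion_iff)
    qed
    ultimately have "AE x in lborel. f x = 0" by eventually_elim auto
    then have "(\<integral>x. f x \<partial>lborel) = 0"
      by (subst integral_cong_AE[where g = "\<lambda>_. 0"]) auto
    then show False using total by simp
  qed
qed

lemma expectation_affine_quadratic_form:
  fixes \<epsilon> :: "'a \<Rightarrow> real^'n" and \<Sigma> :: "real^'n^'n" and T :: "real^'n^'p"
  assumes M: "prob_space M"
    and int: "\<And>a b. integrable M (\<lambda>\<omega>. (a \<bullet> \<epsilon> \<omega>) * (b \<bullet> \<epsilon> \<omega>))" "\<And>a. integrable M (\<lambda>\<omega>. a \<bullet> \<epsilon> \<omega>)"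
    and mean: "\<And>a. (LINT \<omega>|M. a \<bullet> \<epsilon> \<omega>) = 0"
    and cov: "\<And>a b. (LINT \<omega>|M. (a \<bullet> \<epsilon> \<omega>) * (b \<bullet> \<epsilon> \<omega>)) = s * (a \<bullet> (\<Sigma> *v b))"
  shows "(LINT \<omega>|M. (T *v \<epsilon> \<omega> + d) \<bullet> (W *v (T *v \<epsilon> \<omega> + d))) =
    s * trace (W ** (T ** \<Sigma> ** transpose T)) + d \<bullet> (W *v d)"
proof -
  interpret prob_space M by fact
  \<comment> \<open>Coefficient vector of the part linear in the error, which has mean 0.
    \<open>W\<close> is not assumed symmetric here, so the two cross terms contribute
    separately.\<close>
  define w where "w = transpose T *v (W *v d) + transpose T *v (transpose W *v d)"
  have quad: "(T *v e) \<bullet> (W *v (T *v e)) = (\<Sum>i\<in>UNIV. \<Sum>j\<in>UNIV. W $ i $ j * ((T $ j \<bullet> e) * (T $ i \<bullet> e)))" for e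
    unfolding inner_vec_def[of "T *v e"]
    by (simp add: matrix_mult_dot[of T] matrix_vector_mult_def[of W] sum_distrib_left mult_ac)
  have "(T *v e + d) \<bullet> (W *v (T *v e + d)) =
      (\<Sum>i\<in>UNIV. \<Sum>j\<in>UNIV. W $ i $ j * ((T $ j \<bullet> e) * (T $ i \<bullet> e))) + w \<bullet> e + d \<bullet> (W *v d)" for e
  proof -
    have "(W *v d) \<bullet> (T *v e) = (transpose T *v (W *v d)) \<bullet> e"
      "d \<bullet> (W *v (T *v e)) = (transpose T *v (transpose W *v d)) \<bullet> e"
      by (simp_all only: inner_matrix_vector_transpose)
    then show ?thesis unfolding quad[symmetric] w_def
      by (simp add: matrix_vector_right_distrib inner_add_left inner_add_right
          inner_commute[of "T *v e" "W *v d"])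
  qed
  then have "(LINT \<omega>|M. (T *v \<epsilon> \<omega> + d) \<bullet> (W *v (T *v \<epsilon> \<omega> + d))) =
      (\<Sum>i\<in>UNIV. \<Sum>j\<in>UNIV. W $ i $ j * (s * (T $ j \<bullet> (\<Sigma> *v T $ i)))) + d \<bullet> (W *v d)"
    using int mean cov by (simp add: prob_space)
  also have "(\<Sum>i\<in>UNIV. \<Sum>j\<in>UNIV. W $ i $ j * (s * (T $ j \<bullet> (\<Sigma> *v T $ i)))) =
      s * trace (W ** (T ** \<Sigma> ** transpose T))"
    by (simp add: trace_def matrix_matrix_mult_def[of W] matrix_triple_product_nth sum_distrib_left mult_ac)
  finally show ?thesis .
qed

section \<open>Comparison of the risks\<close>

lemma pos_def_gls_C:
  fixes X :: "real^'p^'n"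
  assumes "rank X = CARD('p)" "pos_def V"
  shows "pos_def (gls_C X V)"
  unfolding gls_C_def
proof (rule pos_def_congruence[OF pos_def_matrix_inv[OF assms(2)]])
  show "x = 0" if "X *v x = 0" for x
    using that assms(1) by (metis full_rank_injective injD matrix_vector_mult_0_right)
qed

text \<open>A congruence by the transpose of \<open>H\<close>, which full row rank makes
  injective.\<close>

lemma pos_def_restriction_gram:
  fixes H :: "real^'p^'q"
  assumes "rank H = CARD('q)" "pos_def D"
  shows "pos_def (H ** D ** transpose H)"
proof -
  have "pos_def (transpose (transpose H) ** D ** transpose H)"
  proof (rule pos_def_congruence[OF assms(2)])
    have "inj ((*v) (transpose H))"
      using assms(1) by (simp add: full_rank_injective[symmetric] rank_transpose)
    then show "x = 0" if "transpose H *v x = 0" for x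
      using that by (metis injD matrix_vector_mult_0_right)
  qed
  then show ?thesis by simp
qed

theorem mainTheorem4:
  fixes M :: "'a measure"
    and X :: "real^'p^'n" and V :: "real^'n^'n"
    and H :: "real^'p^'q" and h :: "real^'q"
    and W Q C_ih A :: "real^'p^'p" and A11 :: "real^'q^'q"
    and e :: "'q \<Rightarrow> 'p"
    and \<beta> :: "real^'p" and \<sigma> \<sigma>\<epsilon>2 \<Delta>2 :: real
    and \<epsilon> y :: "'a \<Rightarrow> real^'n" and g :: "real \<Rightarrow> real"
    and \<nu> :: "real set \<Rightarrow> real" and \<nu>p \<nu>m :: "real measure"
  assumes "prob_space M"
    and "CARD('p) < CARD('n)" and "rank X = CARD('p)"
    and "pos_def V" and "\<sigma> > 0"
    and "CARD('q) < CARD('p)" and "rank H = CARD('q)"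
    and "pos_def W"
    and "elliptically_distributed M \<epsilon> 0 (\<sigma>\<^sup>2 *\<^sub>R V) g"
    and "signed_measure (restrict_space borel {0<..}) \<nu>"
    and "jordan_decomposition (restrict_space borel {0<..}) \<nu> \<nu>p \<nu>m"
    and "signed_integral \<nu>p \<nu>m (\<lambda>t. 1) = 1"
    and "integrable \<nu>p (\<lambda>t. 1 / t)" and "integrable \<nu>m (\<lambda>t. 1 / t)"
    and "AE x in lborel. elliptical_density 0 (\<sigma>\<^sup>2 *\<^sub>R V) g x =
           signed_integral \<nu>p \<nu>m (\<lambda>t. mvn_density 0 ((\<sigma>\<^sup>2 / t) *\<^sub>R V) x)"
    and "\<And>\<omega>. y \<omega> = X *v \<beta> + \<epsilon> \<omega>"
    and "\<sigma>\<epsilon>2 = \<sigma>\<^sup>2 * signed_integral \<nu>p \<nu>m (\<lambda>t. 1 / t)"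
    and "\<Delta>2 = restriction_theta X V H h \<beta> / \<sigma>\<epsilon>2"
    and "C_ih = pd_sqrt (matrix_inv (gls_C X V))"
    and "inj e" and "orthogonal_matrix Q"
    and "Q ** (C_ih ** transpose H ** gls_V1 X V H ** H ** C_ih) ** transpose Q = block_id e"
    and "A = Q ** C_ih ** W ** C_ih ** transpose Q"
    and "A11 = upper_left_block e A"
  shows "(\<Delta>2 \<le> trace A11 / ch_max A11 \<longrightarrow>
            quadratic_risk M W (\<lambda>\<omega>. restricted_estimator X V H h (y \<omega>)) \<beta>
              \<le> quadratic_risk M W (\<lambda>\<omega>. gls_estimator X V (y \<omega>)) \<beta>) \<and>
         (\<Delta>2 \<ge> trace A11 / ch_min A11 \<longrightarrow>
            quadratic_risk M W (\<lambda>\<omega>. gls_estimator X V (y \<omega>)) \<beta>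
              \<le> quadratic_risk M W (\<lambda>\<omega>. restricted_estimator X V H h (y \<omega>)) \<beta>)"
proof -
  note [simp del] = transpose_matrix_vector
  note A_eq = \<open>A = _\<close>
  note V = \<open>pos_def V\<close> and W = \<open>pos_def W\<close>
  define D where "D = matrix_inv (gls_C X V)"
  define K where "K = gls_V1 X V H"
  define L where "L = C_ih"
  define Vi where "Vi = matrix_inv V"
  define G where "G = D ** transpose H ** K"
  \<comment> \<open>\<open>T0\<close> and \<open>T1\<close> are the linear parts of the two
    estimation errors as functions of \<epsilon>; the restricted estimator has bias - G
    \<delta>.\<close>
  define T0 where "T0 = D ** transpose X ** Vi"
  define T1 where "T1 = T0 - G ** H ** T0"
  define P where "P = D ** transpose H ** K ** H ** D"
  define J where "J = (block_id e :: real^'p^'p)"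
  define \<delta> where "\<delta> = H *v \<beta> - h"
  define \<theta> where "\<theta> = restriction_theta X V H h \<beta>"
  define \<eta> where "\<eta> = Q *v (L *v (transpose H *v (K *v \<delta>)))"
  define \<eta>1 where "\<eta>1 = (\<chi> j. \<eta> $ e j)"

  have C: "pos_def (gls_C X V)"
    using \<open>rank X = CARD('p)\<close> V by (rule pos_def_gls_C)
  have D: "pos_def D" unfolding D_def by (rule pos_def_matrix_inv[OF C])
  have gram: "pos_def (H ** D ** transpose H)"
    using \<open>rank H = CARD('q)\<close> D by (rule pos_def_restriction_gram)
  have K_inv: "K = matrix_inv (H ** D ** transpose H)"
    by (simp add: K_def gls_V1_def D_def)
  have K: "pos_def K" unfolding K_inv by (rule pos_def_matrix_inv[OF gram])
  have L: "pos_def L" "L ** L = D"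
    using pd_sqrt[OF D] \<open>C_ih = _\<close> by (simp_all add: L_def D_def)
  have Vi: "pos_def Vi" unfolding Vi_def by (rule pos_def_matrix_inv[OF V])
  have Q: "transpose Q ** Q = mat 1" "Q ** transpose Q = mat 1"
    using \<open>orthogonal_matrix Q\<close> by (simp_all add: orthogonal_matrix_def)
  note sym = pos_def_sym[OF D] pos_def_sym[OF K] pos_def_sym[OF L(1)] pos_def_sym[OF V]
    pos_def_sym[OF W] pos_def_sym[OF Vi]

  \<comment> \<open>The cancellations are stated as actions on vectors, so that they apply inside
    any longer product once it is unfolded into nested applications.\<close>
  have LL: "L *v (L *v x) = D *v x" for x
    by (simp add: matrix_vector_mul_assoc L)
  have VV: "V *v (Vi *v x) = x" for x
    by (simp add: matrix_vector_mul_assoc Vi_def matrix_inv_mult pos_def_invertible[OF V])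
  have KR: "K *v (H *v (D *v (transpose H *v x))) = x"
    "H *v (D *v (transpose H *v (K *v x))) = x" for x
    using matrix_inv_mult[OF pos_def_invertible[OF gram]]
    by (simp_all add: matrix_vector_mul_assoc matrix_mul_assoc K_inv)
  have DC: "D *v (transpose X *v (Vi *v (X *v x))) = x" for x
    using matrix_inv_mult(2)[OF pos_def_invertible[OF C]]
    by (simp add: matrix_vector_mul_assoc matrix_mul_assoc D_def gls_C_def Vi_def)
  have QQ: "transpose Q *v (Q *v x) = x" "Q *v (transpose Q *v x) = x" for x
    by (simp_all add: matrix_vector_mul_assoc Q)
  have QJ: "Q *v (L *v (transpose H *v (K *v (H *v (L *v (transpose Q *v x)))))) = J *v x" for x
    using \<open>Q ** (C_ih ** _ ** _ ** _ ** _) ** _ = _\<close>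
    by (simp add: matrix_vector_mul_assoc matrix_mul_assoc K_def L_def J_def)
  note vec = matrix_vector_mul_assoc[symmetric]

  have T0_cov: "T0 ** V ** transpose T0 = D"
    unfolding matrix_eq T0_def by (simp add: matrix_transpose_mul sym vec VV DC)
  \<comment> \<open>T1 = (I - GH) T0 has covariance factor (I - GH) D (I - GH)'. Both cross terms
    equal P, and so does the last term because K inverts H D H', leaving D - P - (P - P).\<close>
  have T1_cov: "T1 ** V ** transpose T1 = D - P"
  proof -
    have "T1 ** V ** transpose T1 = T0 ** V ** transpose T0 - T0 ** V ** transpose T0 ** transpose (G ** H)
        - (G ** H ** (T0 ** V ** transpose T0) - G ** H ** (T0 ** V ** transpose T0) ** transpose (G ** H))"
      by (simp add: T1_def matrix_diff_ldistrib matrix_diff_rdistrib transpose_diff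
          matrix_transpose_mul matrix_mul_assoc)
    also have "\<dots> = D - P"
      unfolding T0_cov matrix_eq G_def P_def
      by (simp add: matrix_vector_mult_diff_rdistrib matrix_transpose_mul sym vec KR)
    finally show ?thesis .
  qed

  \<comment> \<open>This form gives positive definiteness of \<open>A\<close> and later carries the
    bias term over to \<open>\<eta>\<close>.\<close>
  have A_congr: "A = transpose (L ** transpose Q) ** W ** (L ** transpose Q)"
    by (simp add: A_eq L_def[symmetric] matrix_transpose_mul matrix_mul_assoc sym)
  have "pos_def A"
    unfolding A_congr
  proof (rule pos_def_congruence[OF W])
    fix x :: "real^'p" assume "(L ** transpose Q) *v x = 0"
    then have "L *v (transpose Q *v x) = 0" by (simp add: vec)
    then have "transpose Q *v x = 0"
      using pos_def_pos[OF L(1), of "transpose Q *v x"] by force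
    then show "x = 0" using QQ(2)[of x] by simp
  qed
  then have A11: "pos_def A11"
    unfolding \<open>A11 = _\<close> using \<open>inj e\<close> by (rule pos_def_upper_left_block)

  \<comment> \<open>Inserting Q'Q = I on both sides gives P = L Q' J Q L; two cyclic shifts then
    assemble \<open>A\<close> next to \<open>J\<close>.\<close>
  have "trace (W ** P) = trace ((W ** L ** transpose Q ** J ** Q) ** L)"
  proof -
    have "P *v x = L *v (transpose Q *v (J *v (Q *v (L *v x))))" for x
      by (simp add: P_def vec QJ[symmetric] QQ LL)
    then have "W ** P = W ** L ** transpose Q ** J ** Q ** L"
      unfolding matrix_eq by (simp add: vec)
    then show ?thesis by simp
  qed
  also have "\<dots> = trace ((L ** W ** L ** transpose Q ** J) ** Q)"
    by (subst trace_mul_sym) (simp add: matrix_mul_assoc)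
  also have "\<dots> = trace (A ** J)"
    by (subst trace_mul_sym) (simp add: A_eq L_def matrix_mul_assoc)
  also have "\<dots> = trace A11"
    unfolding J_def \<open>A11 = _\<close> using \<open>inj e\<close> by (rule trace_mult_block_id)
  finally have trP: "trace (W ** P) = trace A11" .

  \<comment> \<open>\<open>\<eta>\<close> lies in the range of the projection J: two copies of H' K
    meet around H D, and H D H' K = I removes one of them.\<close>
  have "J *v \<eta> = \<eta>"
    by (simp add: \<eta>_def QJ[symmetric] QQ LL KR)
  then have \<eta>0: "\<eta> $ i = 0" if "i \<notin> range e" for i
    using that unfolding J_def by (rule block_id_fixed_vanishes)
  \<comment> \<open>The orthogonal factor drops out, leaving \<delta>' K H D H' K \<delta> =
    \<delta>' K \<delta>.\<close>
  have "\<eta> \<bullet> \<eta> = (L *v (transpose H *v (K *v \<delta>))) \<bullet> (L *v (transpose H *v (K *v \<delta>)))"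
    unfolding \<eta>_def by (simp add: inner_matrix_vector_transpose[of _ Q] QQ)
  also have "\<dots> = (K *v \<delta>) \<bullet> \<delta>"
    by (simp add: inner_matrix_vector_transpose[of _ L] inner_matrix_vector_transpose[of _ "transpose H"]
        inner_commute[of \<delta>] sym LL KR)
  also have "\<dots> = \<theta>"
    by (simp add: \<theta>_def restriction_theta_def \<delta>_def K_def inner_commute)
  finally have "\<eta> \<bullet> \<eta> = \<theta>" .
  then have \<theta>: "\<eta>1 \<bullet> \<eta>1 = \<theta>"
    using upper_left_block_quadratic_form(2)[OF \<open>inj e\<close> \<eta>0] by (simp add: \<eta>1_def)
  have "G *v \<delta> = (L ** transpose Q) *v \<eta>"
    by (simp add: G_def \<eta>_def vec QQ LL)
  then have "(G *v \<delta>) \<bullet> (W *v (G *v \<delta>)) = \<eta> \<bullet> (A *v \<eta>)"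
    unfolding A_congr
    by (simp only: vec inner_matrix_vector_transpose[of \<eta> "transpose _"] transpose_transpose)
  also have "\<dots> = \<eta>1 \<bullet> (A11 *v \<eta>1)"
    unfolding \<eta>1_def \<open>A11 = _\<close>
    by (rule upper_left_block_quadratic_form(1)[OF \<open>inj e\<close> \<eta>0])
  finally have bias: "(- (G *v \<delta>)) \<bullet> (W *v (- (G *v \<delta>))) = \<eta>1 \<bullet> (A11 *v \<eta>1)"
    using matrix_vector_mult_scaleR[of W "- 1" "G *v \<delta>"] by simp

  have jd: "finite_measure \<nu>p" "sets \<nu>p = sets (restrict_space borel {0<..})"
    "finite_measure \<nu>m" "sets \<nu>m = sets (restrict_space borel {0<..})"
    using \<open>jordan_decomposition _ _ _ _\<close> by (simp_all add: jordan_decomposition_def)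
  have S: "pos_def (\<sigma>\<^sup>2 *\<^sub>R V)" using V \<open>\<sigma> > 0\<close> by (simp add: pos_def_scaleR)
  have "AE x in lborel. elliptical_density 0 (\<sigma>\<^sup>2 *\<^sub>R V) g x =
      signed_integral \<nu>p \<nu>m (\<lambda>t. mvn_density 0 ((1 / t) *\<^sub>R (\<sigma>\<^sup>2 *\<^sub>R V)) x)"
    using assms(15) by simp
  note mom = elliptical_mixture_moments[OF \<open>prob_space M\<close> S \<open>elliptically_distributed _ _ _ _ _\<close>
      jd(1,2) \<open>integrable \<nu>p _\<close> jd(3,4) \<open>integrable \<nu>m _\<close> \<open>signed_integral _ _ _ = 1\<close> this]
  \<comment> \<open>This sign allows the denominators in the conditions on \<open>\<Delta>2\<close>
    to be cleared.\<close>
  have s: "\<sigma>\<epsilon>2 > 0" using mom(1) \<open>\<sigma> > 0\<close> by (simp add: \<open>\<sigma>\<epsilon>2 = _\<close>)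
  have cov: "(LINT \<omega>|M. (a \<bullet> \<epsilon> \<omega>) * (b \<bullet> \<epsilon> \<omega>)) = \<sigma>\<epsilon>2 * (a \<bullet> (V *v b))" for a b
    using mom(3)[of a b] by (simp add: \<open>\<sigma>\<epsilon>2 = _\<close> scaleR_matrix_vector_assoc[symmetric])
  note risk = expectation_affine_quadratic_form[OF \<open>prob_space M\<close> mom(2,4,5) cov]

  \<comment> \<open>Unbiasedness: T0 X = I, so only the error term remains beside \<beta>.\<close>
  have gls: "gls_estimator X V (y \<omega>) = \<beta> + T0 *v \<epsilon> \<omega>" for \<omega>
    unfolding gls_estimator_def D_def[symmetric] Vi_def[symmetric] T0_def[symmetric] \<open>\<And>\<omega>. y \<omega> = _\<close>
    by (simp add: matrix_vector_right_distrib) (simp add: T0_def vec DC)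
  have restr: "restricted_estimator X V H h (y \<omega>) - \<beta> = T1 *v \<epsilon> \<omega> + - (G *v \<delta>)" for \<omega>
    unfolding restricted_estimator_def gls D_def[symmetric] K_def[symmetric] G_def[symmetric] T1_def \<delta>_def
    by (simp add: vec matrix_vector_mult_diff_rdistrib matrix_vector_right_distrib
        matrix_vector_mult_diff_distrib)
  have R0: "quadratic_risk M W (\<lambda>\<omega>. gls_estimator X V (y \<omega>)) \<beta> = \<sigma>\<epsilon>2 * trace (W ** D)"
    unfolding quadratic_risk_def gls using risk[of T0 0 W] by (simp add: T0_cov)
  have R1: "quadratic_risk M W (\<lambda>\<omega>. restricted_estimator X V H h (y \<omega>)) \<beta> =
      \<sigma>\<epsilon>2 * (trace (W ** D) - trace A11) + \<eta>1 \<bullet> (A11 *v \<eta>1)"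
    unfolding quadratic_risk_def restr risk T1_cov bias
    by (simp add: matrix_diff_ldistrib trace_sub trP)

  note ray = Rayleigh_bounds[OF pos_def_sym[OF A11]]
  have pos: "ch_min A11 > 0" "ch_max A11 > 0"
    using ray(3,4) A11 by (auto intro: pos_def_eigenvalue_pos)
  have \<Delta>: "\<Delta>2 = \<theta> / \<sigma>\<epsilon>2" by (simp add: \<open>\<Delta>2 = _\<close> \<theta>_def)
  show ?thesis
  proof (intro conjI impI)
    assume "\<Delta>2 \<le> trace A11 / ch_max A11"
    \<comment> \<open>Here \<theta> is the squared length of \<open>\<eta>1\<close>, so the left
      side is the upper Rayleigh bound for the bias term in \<open>R1\<close>.\<close>
    then have "ch_max A11 * \<theta> \<le> \<sigma>\<epsilon>2 * trace A11"
      using pos s by (simp add: \<Delta> field_simps)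
    then show "quadratic_risk M W (\<lambda>\<omega>. restricted_estimator X V H h (y \<omega>)) \<beta>
        \<le> quadratic_risk M W (\<lambda>\<omega>. gls_estimator X V (y \<omega>)) \<beta>"
      unfolding R0 R1 using ray(2)[of \<eta>1] \<theta> by (simp add: algebra_simps)
  next
    assume "\<Delta>2 \<ge> trace A11 / ch_min A11"
    then have "\<sigma>\<epsilon>2 * trace A11 \<le> ch_min A11 * \<theta>"
      using pos s by (simp add: \<Delta> field_simps)
    then show "quadratic_risk M W (\<lambda>\<omega>. gls_estimator X V (y \<omega>)) \<beta>
        \<le> quadratic_risk M W (\<lambda>\<omega>. restricted_estimator X V H h (y \<omega>)) \<beta>"
      unfolding R0 R1 using ray(1)[of \<eta>1] \<theta> by (simp add: algebra_simps)
  qed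
qed

end
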